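(* Let $V$ be a finite-dimensional real vector space, let $D\subset V$ be a bounded convex domain, and let $d$ be the Hilbert metric on $D$. Suppose that for all $x,y,z,w\in D$ and all $s\in[0,1]$, $$d\big(sx+(1-s)y,\;sz+(1-s)w\big)\le \max\{d(x,z),d(y,w)\}.$$ Let $F:D\to D$ be a nonexpansive mapping with respect to $d$ without fixed points, and let $\{R_\lambda\}_{\lambda>0}$, $R_\lambda:D\to D$, be the family of resolvents of $F$. Then $$\operatorname{co}\,\Omega_{\{R_\lambda\}_{\lambda>0}}\subseteq \partial D,$$ where $\operatorname{co}$ denotes the convex hull and $\Omega_{\{R_\lambda\}_{\lambda>0}}$ is the attractor of the family of resolvents.
   Context: $V$ carries a norm $\|\cdot\|$ (its topology is the usual Euclidean one); a domain is a nonempty open connected set; $\overline D$ is the norm closure of $D$ and $\partial D=\overline D\setminus D$. Hilbert metric: for distinct $x,y\in D$, the straight line through $x$ and $y$ meets $\partial D$ in exactly two points $a,b$, labelled so that $x$ is between $a$ and $y$, and $y$ is between $x$ and $b$. Then $d(x,y)=\log\left(\frac{\|y-a\|\,\|x-b\|}{\|x-a\|\,\|y-b\|}\right)$, and $d(x,x)=0$. A map $F:D\to D$ is nonexpansive (with respect to $d$) if $d(F(x),F(y))\le d(x,y)$ for all $x,y\in D$. Resolvents: for a nonexpansive $F:D\to D$, $x\in D$ and $\lambda>0$, the map $G_{x,\lambda}(y)=\frac{1}{1+\lambda}x+\frac{\lambda}{1+\lambda}F(y)$, $y\in D$, maps $D$ into $D$ and has a unique fixed point $z\in D$; the resolvent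 is defined by $R_\lambda(x)=z$. Thus $R_\lambda(x)$ is the unique point of $D$ satisfying $R_\lambda(x)=\frac{1}{1+\lambda}x+\frac{\lambda}{1+\lambda}F(R_\lambda(x))$. Omega limit sets and attractor: for $x\in D$, $\omega_{\{R_\lambda\}_{\lambda>0}}(x)$ is the set of $y\in\overline D$ such that $\|R_{\lambda_n}(x)-y\|\to 0$ for some increasing sequence $\{\lambda_n\}$ with $\lambda_n\to\infty$; and $\Omega_{\{R_\lambda\}_{\lambda>0}}=\bigcup_{x\in D}\omega_{\{R_\lambda\}_{\lambda>0}}(x)$. *)

theory Defs
  imports "HOL-Analysis.Analysis"
begin

text \<open>
  The boundary of \<open>D\<close> is \<open>closure D - D\<close>. For a bounded convex open \<open>D\<close> and distinct
  \<open>x, y \<in> D\<close> the point below exists and is unique: it is where the straight line through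
  \<open>x\<close> and \<open>y\<close> leaves \<open>D\<close> on the side of \<open>y\<close>.
\<close>

definition exit_point :: "'a::real_normed_vector set \<Rightarrow> 'a \<Rightarrow> 'a \<Rightarrow> 'a" where
  "exit_point D x y = (THE b. b \<in> closure D - D \<and> y \<in> open_segment x b)"

definition hilbert_dist :: "'a::real_normed_vector set \<Rightarrow> 'a \<Rightarrow> 'a \<Rightarrow> real" where
  "hilbert_dist D x y =
     (if x = y then 0
      else let a = exit_point D y x; b = exit_point D x y
           in ln ((norm (y - a) * norm (x - b)) / (norm (x - a) * norm (y - b))))"

definition hilbert_nonexpansive :: "'a::real_normed_vector set \<Rightarrow> ('a \<Rightarrow> 'a) \<Rightarrow> bool" where
  "hilbert_nonexpansive D F \<longleftrightarrow>
     (\<forall>x\<in>D. \<forall>y\<in>D. hilbert_dist D (F x) (F y) \<le> hilbert_dist D x y)"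

definition resolvent ::
    "'a::real_normed_vector set \<Rightarrow> ('a \<Rightarrow> 'a) \<Rightarrow> real \<Rightarrow> 'a \<Rightarrow> 'a" where
  "resolvent D F l x =
     (THE z. z \<in> D \<and> z = (1 / (1 + l)) *\<^sub>R x + (l / (1 + l)) *\<^sub>R F z)"

text \<open>
  A family \<open>R\<close> indexed by the positive reals is a function on \<open>real\<close>; only its values at
  positive parameters are used. Requiring \<open>l\<close> to be strictly increasing would give the same
  set, since \<open>l\<close> tends to infinity.
\<close>

definition omega_limit ::
    "'a::real_normed_vector set \<Rightarrow> (real \<Rightarrow> 'a \<Rightarrow> 'a) \<Rightarrow> 'a \<Rightarrow> 'a set" where
  "omega_limit D R x =
     {y \<in> closure D. \<exists>l :: nat \<Rightarrow> real.
        (\<forall>n. l n > 0) \<and> incseq l \<and> filterlim l at_top sequentially \<and>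
        (\<lambda>n. norm (R (l n) x - y)) \<longlonglongrightarrow> 0}"

definition attractor ::
    "'a::real_normed_vector set \<Rightarrow> (real \<Rightarrow> 'a \<Rightarrow> 'a) \<Rightarrow> 'a set" where
  "attractor D R = (\<Union>x\<in>D. omega_limit D R x)"

end

theory Submission
  imports Defs
begin

text \<open>
  Write \<open>exp (d x y) = M x y * M y x\<close>, where \<open>M x y = \<bar>x - b\<bar> / \<bar>y - b\<bar>\<close> is the least \<open>t \<ge> 1\<close>
  such that \<open>t y\<close> is the sum of \<open>x\<close> and \<open>t - 1\<close> times a point of the closure of \<open>D\<close>; this form of
  \<open>M\<close> also makes sense on the boundary. Limit points of resolvents are not in \<open>D\<close>, since they would
  be fixed points of \<open>F\<close>. Let \<open>y n = R (m n) x0\<close> tend to \<open>z\<close>. The resolvents are nonexpansive, and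
  with the resolvent identity this gives \<open>d (R l x) (y n) \<le> d x0 (y n) + d x x0\<close> as soon as
  \<open>l \<le> m n\<close>. Consequently every \<open>u\<close> in the attractor either has \<open>z\<close> in its face or satisfies
  \<open>M u (y n) = o(M x0 (y n))\<close>, up to approximation of \<open>u\<close>. The points with the latter property form
  a convex set, which is disjoint from \<open>D\<close> and contains \<open>z\<close> together with its face. Given finitely
  many points of the attractor, choose \<open>z\<close> among them with a maximal face: then all of them, hence
  also their convex hull, lie in that convex set.
\<close>

section \<open>Segments into an open convex set, and the cone order\<close>

text \<open>Replace \<open>c\<close> by a nearby point \<open>c'\<close> of \<open>D\<close> and
  move \<open>x\<close> to compensate, so that the convex combination is unchanged; openness keeps
  the moved point in \<open>D\<close>.\<close>

lemma open_segment_subset_open_convex: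
  fixes D :: "'a::real_normed_vector set"
  assumes "open D" "convex D" "x \<in> D" "c \<in> closure D" "0 \<le> t" "t < 1"
  shows "(1 - t) *\<^sub>R x + t *\<^sub>R c \<in> D"
proof -
  obtain e where e: "e > 0" "ball x e \<subseteq> D"
    using assms openE by blast
  \<comment> \<open>The displacement of \<open>x\<close> must satisfy \<open>(1 - t) * k = t\<close>
    to cancel the change from \<open>c\<close> to \<open>c'\<close>.\<close>
  define k where "k = t / (1 - t)"
  have k: "k \<ge> 0" using assms by (simp add: k_def)
  obtain c' where c': "c' \<in> D" "dist c' c < e / (k + 1)"
    using assms(4) e k closure_approachable[of c D] by (meson divide_pos_pos add_nonneg_pos zero_less_one)
  define x' where "x' = x + k *\<^sub>R (c - c')"
  have "dist x x' = k * dist c' c"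
    using k by (simp add: x'_def dist_norm norm_minus_commute)
  also have "\<dots> \<le> (k + 1) * dist c' c" by (simp add: algebra_simps)
  also have "\<dots> < e" using c' k by (simp add: field_simps)
  finally have "x' \<in> D" using e by auto
  moreover have "(1 - t) *\<^sub>R x + t *\<^sub>R c = (1 - t) *\<^sub>R x' + t *\<^sub>R c'"
    using assms by (simp add: x'_def k_def scaleR_right_distrib scaleR_diff_right)
  ultimately show ?thesis
    using convexD_alt[OF assms(2), of x' c' t] c' assms by simp
qed

text \<open>
  The order of the cone over the closure of \<open>D\<close>: \<open>t (y, 1) - (u, 1)\<close> belongs to the cone. For \<open>y\<close> in
  the boundary, \<open>\<exists>t. dominated D t u y\<close> says that \<open>u\<close> lies in the smallest face containing \<open>y\<close>.
\<close>

definition dominated :: "'a::real_normed_vector set \<Rightarrow> real \<Rightarrow> 'a \<Rightarrow> 'a \<Rightarrow> bool" where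
  "dominated D t u y \<longleftrightarrow> 1 \<le> t \<and> (\<exists>c\<in>closure D. t *\<^sub>R y = u + (t - 1) *\<^sub>R c)"

text \<open>Its logarithm is the Funk weak metric. For \<open>x = y\<close> no line and hence no
  exit point is determined; the value 1 is then the least constant of domination.\<close>

definition order_ratio :: "'a::real_normed_vector set \<Rightarrow> 'a \<Rightarrow> 'a \<Rightarrow> real" where
  "order_ratio D x y =
     (if x = y then 1 else norm (x - exit_point D x y) / norm (y - exit_point D x y))"

lemma dominated_ge_1: "dominated D t u y \<Longrightarrow> 1 \<le> t"
  by (simp add: dominated_def)

text \<open>For \<open>t > 1\<close> the witness \<open>c\<close> is determined by \<open>t\<close>,
  \<open>u\<close> and \<open>y\<close>, so domination becomes membership in a closed set.\<close>

lemma dominated_iff: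
  assumes "1 < t"
  shows "dominated D t u y \<longleftrightarrow> (1 / (t - 1)) *\<^sub>R (t *\<^sub>R y - u) \<in> closure D"
proof
  assume "dominated D t u y"
  then obtain c where "c \<in> closure D" "t *\<^sub>R y = u + (t - 1) *\<^sub>R c"
    by (auto simp: dominated_def)
  then show "(1 / (t - 1)) *\<^sub>R (t *\<^sub>R y - u) \<in> closure D"
    using assms by simp
next
  assume "(1 / (t - 1)) *\<^sub>R (t *\<^sub>R y - u) \<in> closure D"
  then show "dominated D t u y"
    using assms unfolding dominated_def
    by (intro conjI bexI[of _ "(1 / (t - 1)) *\<^sub>R (t *\<^sub>R y - u)"]) auto
qed

text \<open>The witnesses converge. If their limit lay outside the closed set
  \<open>closure D\<close>, they would eventually lie outside as well, so domination infinitely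
  often suffices.\<close>

lemma dominated_limit:
  assumes "1 < t" "u \<longlonglongrightarrow> u'" "y \<longlonglongrightarrow> y'"
    and "\<exists>\<^sub>F n in sequentially. dominated D t (u n) (y n)"
  shows "dominated D t u' y'"
proof (rule ccontr)
  define c where "c n = (1 / (t - 1)) *\<^sub>R (t *\<^sub>R y n - u n)" for n
  define c' where "c' = (1 / (t - 1)) *\<^sub>R (t *\<^sub>R y' - u')"
  assume "\<not> dominated D t u' y'"
  then have "c' \<in> - closure D"
    using dominated_iff[OF assms(1)] by (auto simp: c'_def)
  moreover have "c \<longlonglongrightarrow> c'"
    unfolding c_def c'_def by (intro tendsto_intros assms)
  ultimately have "\<forall>\<^sub>F n in sequentially. c n \<in> - closure D"
    using topological_tendstoD[of c c' sequentially "- closure D"] open_Compl[OF closed_closure]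
    by blast
  with assms(4) show False
    unfolding dominated_iff[OF assms(1)] c_def frequently_def by (auto elim: eventually_mono)
qed

section \<open>Calculus of the cone order\<close>

locale bounded_convex_domain =
  fixes D :: "'a::real_normed_vector set"
  assumes open_D: "open D" and bounded_D: "bounded D" and convex_D: "convex D"
begin

lemma convex_closure_D: "convex (closure D)"
  by (simp add: convex_D convex_closure)

lemma in_closure: "x \<in> D \<Longrightarrow> x \<in> closure D"
  using closure_subset by blast

lemma dominated_refl: "u \<in> closure D \<Longrightarrow> dominated D 1 u u"
  by (auto simp: dominated_def)

text \<open>The surplus \<open>(t' - t) y\<close> is absorbed into the witness, which becomes a
  weighted mean of \<open>c\<close> and \<open>y\<close>.\<close>

lemma dominated_mono:
  assumes "dominated D t u y" "t \<le> t'" "y \<in> closure D"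
  shows "dominated D t' u y"
proof (cases "t' = 1")
  case True
  then show ?thesis using assms dominated_ge_1[OF assms(1)] by simp
next
  case False
  obtain c where c: "c \<in> closure D" "t *\<^sub>R y = u + (t - 1) *\<^sub>R c" and t: "1 \<le> t"
    using assms by (auto simp: dominated_def)
  have t': "t' > 1" using False t assms by simp
  define c' where "c' = ((t - 1) / (t' - 1)) *\<^sub>R c + ((t' - t) / (t' - 1)) *\<^sub>R y"
  have "c' \<in> closure D"
    unfolding c'_def
    by (rule convexD[OF convex_closure_D c(1) assms(3)])
       (use t t' assms in \<open>auto simp: add_divide_distrib[symmetric]\<close>)
  moreover have "t' *\<^sub>R y = u + (t' - 1) *\<^sub>R c'"
  proof -
    have "t' *\<^sub>R y = t *\<^sub>R y + (t' - t) *\<^sub>R y" by (simp add: algebra_simps)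
    also have "\<dots> = u + ((t - 1) *\<^sub>R c + (t' - t) *\<^sub>R y)" using c by simp
    also have "(t - 1) *\<^sub>R c + (t' - t) *\<^sub>R y = (t' - 1) *\<^sub>R c'"
      using t' by (simp add: c'_def scaleR_right_distrib)
    finally show ?thesis .
  qed
  ultimately show ?thesis using t' by (auto simp: dominated_def)
qed

text \<open>Add the two defining equations with weights \<open>a\<close> and \<open>b\<close>; the
  new witness is the mean of the old ones with weights proportional to \<open>a * (t - 1)\<close>
  and \<open>b * (t' - 1)\<close>.\<close>

lemma dominated_convex:
  assumes "dominated D t u y" "dominated D t' u' y" "0 \<le> a" "0 \<le> b" "a + b = 1"
  shows "dominated D (a * t + b * t') (a *\<^sub>R u + b *\<^sub>R u') y"
proof -
  obtain c where c: "c \<in> closure D" "t *\<^sub>R y = u + (t - 1) *\<^sub>R c" and t: "1 \<le> t"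
    using assms by (auto simp: dominated_def)
  obtain c' where c': "c' \<in> closure D" "t' *\<^sub>R y = u' + (t' - 1) *\<^sub>R c'" and t': "1 \<le> t'"
    using assms by (auto simp: dominated_def)
  define w where "w = a * (t - 1) + b * (t' - 1)"
  have w: "w = a * t + b * t' - 1" using assms by (simp add: w_def algebra_simps)
  have ab: "a * (t - 1) \<ge> 0" "b * (t' - 1) \<ge> 0" using t t' assms by auto
  have "(a * t + b * t') *\<^sub>R y = a *\<^sub>R (t *\<^sub>R y) + b *\<^sub>R (t' *\<^sub>R y)"
    by (simp add: algebra_simps)
  also have "\<dots> = (a *\<^sub>R u + b *\<^sub>R u') + ((a * (t - 1)) *\<^sub>R c + (b * (t' - 1)) *\<^sub>R c')"
    unfolding c(2) c'(2) by (simp add: algebra_simps)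
  finally have eq: "(a * t + b * t') *\<^sub>R y =
      (a *\<^sub>R u + b *\<^sub>R u') + ((a * (t - 1)) *\<^sub>R c + (b * (t' - 1)) *\<^sub>R c')" .
  show ?thesis
  proof (cases "w = 0")
    case True
    then have "a * (t - 1) = 0" "b * (t' - 1) = 0" using ab w_def by linarith+
    then show ?thesis using eq w True c(1) unfolding dominated_def
      by (intro conjI bexI[of _ c]) auto
  next
    case False
    then have wp: "w > 0" using ab w_def by linarith
    have "(a * (t - 1) / w) *\<^sub>R c + (b * (t' - 1) / w) *\<^sub>R c' \<in> closure D"
      by (rule convexD[OF convex_closure_D c(1) c'(1)])
         (use ab wp in \<open>auto simp: add_divide_distrib[symmetric] w_def[symmetric]\<close>)
    moreover have "(a * (t - 1)) *\<^sub>R c + (b * (t' - 1)) *\<^sub>R c' =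
        w *\<^sub>R ((a * (t - 1) / w) *\<^sub>R c + (b * (t' - 1) / w) *\<^sub>R c')"
      using wp by (simp add: scaleR_right_distrib)
    ultimately show ?thesis using eq w wp unfolding dominated_def by auto
  qed
qed

text \<open>Constants multiply because \<open>t s z - x = t (s z - y) + (t y - x)\<close>, a sum of
  two vectors of the cone.\<close>

lemma dominated_trans:
  assumes "dominated D t x y" "dominated D s y z"
  shows "dominated D (t * s) x z"
proof -
  obtain c where c: "c \<in> closure D" "t *\<^sub>R y = x + (t - 1) *\<^sub>R c" and t: "1 \<le> t"
    using assms by (auto simp: dominated_def)
  obtain c' where c': "c' \<in> closure D" "s *\<^sub>R z = y + (s - 1) *\<^sub>R c'" and s: "1 \<le> s"
    using assms by (auto simp: dominated_def)
  have "t * s \<ge> 1" using t s by (metis mult_mono mult_1 zero_le_one order_trans)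
  have "(t * s) *\<^sub>R z = t *\<^sub>R (s *\<^sub>R z)" by simp
  also have "\<dots> = t *\<^sub>R y + (t * (s - 1)) *\<^sub>R c'" unfolding c' by (simp add: algebra_simps)
  finally have eq: "(t * s) *\<^sub>R z = x + ((t - 1) *\<^sub>R c + (t * (s - 1)) *\<^sub>R c')"
    unfolding c by (simp add: add.assoc)
  have nn: "t - 1 \<ge> 0" "t * (s - 1) \<ge> 0" using t s by auto
  have w: "t * s - 1 = (t - 1) + t * (s - 1)" by (simp add: algebra_simps)
  show ?thesis
  proof (cases "t * s = 1")
    case True
    then have "t - 1 = 0" "t * (s - 1) = 0" using nn w by linarith+
    then show ?thesis using eq True c(1) unfolding dominated_def
      by (intro conjI bexI[of _ c]) auto
  next
    case False
    define w where "w = t * s - 1"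
    have wp: "w > 0" using False \<open>t * s \<ge> 1\<close> w_def by simp
    have "((t - 1) / w) *\<^sub>R c + (t * (s - 1) / w) *\<^sub>R c' \<in> closure D"
      by (rule convexD[OF convex_closure_D c(1) c'(1)])
         (use nn wp in \<open>auto simp: add_divide_distrib[symmetric] w[symmetric] w_def[symmetric]\<close>)
    moreover have "(t - 1) *\<^sub>R c + (t * (s - 1)) *\<^sub>R c' =
        w *\<^sub>R (((t - 1) / w) *\<^sub>R c + (t * (s - 1) / w) *\<^sub>R c')"
      using wp by (simp add: scaleR_right_distrib)
    ultimately show ?thesis using eq w_def wp unfolding dominated_def by auto
  qed
qed

text \<open>The error \<open>u - u'\<close> is absorbed by the ball about \<open>x\<close>: with
  \<open>k = norm (u - u') / r\<close>, the vector \<open>k x + (u - u')\<close> is \<open>k\<close>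
  times a point at distance \<open>r\<close> from \<open>x\<close>. Adding \<open>k\<close> copies
  of the domination of \<open>x\<close> costs \<open>k * m\<close>.\<close>

lemma dominated_perturb:
  assumes "dominated D t u y" "dominated D m x y" "cball x r \<subseteq> closure D" "r > 0" "y \<in> closure D"
  shows "dominated D (t + norm (u - u') / r * m) u' y"
proof (cases "u = u'")
  case True
  then show ?thesis using assms by simp
next
  case False
  obtain c where c: "c \<in> closure D" "t *\<^sub>R y = u + (t - 1) *\<^sub>R c" and t: "1 \<le> t"
    using assms by (auto simp: dominated_def)
  obtain b where b: "b \<in> closure D" "m *\<^sub>R y = x + (m - 1) *\<^sub>R b" and m: "1 \<le> m"
    using assms by (auto simp: dominated_def)
  define k where "k = norm (u - u') / r"
  have k: "k > 0" using False assms by (simp add: k_def)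
  define x' where "x' = x + (1 / k) *\<^sub>R (u - u')"
  have "dist x x' = norm (u - u') / k" using k by (simp add: x'_def dist_norm)
  also have "\<dots> = r" using False assms by (simp add: k_def)
  finally have x': "x' \<in> closure D" using assms by auto
  have b': "(1 / m) *\<^sub>R x' + ((m - 1) / m) *\<^sub>R b \<in> closure D"
    by (rule convexD[OF convex_closure_D x' b(1)]) (use m in \<open>auto simp: field_simps\<close>)
  define b' where "b' = (1 / m) *\<^sub>R x' + ((m - 1) / m) *\<^sub>R b"
  have mb': "m *\<^sub>R b' = x' + (m - 1) *\<^sub>R b" using m by (simp add: b'_def scaleR_right_distrib)
  have km: "k * m > 0" using k m by simp
  define w where "w = t + k * m - 1"
  have wp: "w > 0" using km t w_def by simp
  have cc: "((t - 1) / w) *\<^sub>R c + (k * m / w) *\<^sub>R b' \<in> closure D"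
    by (rule convexD[OF convex_closure_D c(1)])
       (use b'_def b' t km wp in \<open>auto simp: add_divide_distrib[symmetric] w_def\<close>)
  have "(t + k * m) *\<^sub>R y = t *\<^sub>R y + k *\<^sub>R (m *\<^sub>R y)" by (simp add: algebra_simps)
  also have "\<dots> = u' + ((t - 1) *\<^sub>R c + ((u - u') + k *\<^sub>R x) + k *\<^sub>R (m - 1) *\<^sub>R b)"
    unfolding c(2) b(2) by (simp add: algebra_simps)
  also have "(u - u') + k *\<^sub>R x = k *\<^sub>R x'" using k by (simp add: x'_def scaleR_right_distrib)
  also have "(t - 1) *\<^sub>R c + k *\<^sub>R x' + k *\<^sub>R (m - 1) *\<^sub>R b = (t - 1) *\<^sub>R c + (k * m) *\<^sub>R b'"
    using mb' by (simp add: add.assoc flip: scaleR_scaleR scaleR_right_distrib)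
  also have "\<dots> = w *\<^sub>R (((t - 1) / w) *\<^sub>R c + (k * m / w) *\<^sub>R b')"
    using wp by (simp add: scaleR_right_distrib)
  finally show ?thesis using cc wp unfolding dominated_def k_def[symmetric] w_def by auto
qed

text \<open>\<open>y\<close> is a convex combination of \<open>x\<close> and a point of the closure
  in which the interior point \<open>x\<close> has the positive weight \<open>1 / t\<close>.\<close>

lemma dominated_interior:
  assumes "dominated D t x y" "x \<in> D"
  shows "y \<in> D"
proof -
  obtain c where c: "c \<in> closure D" "t *\<^sub>R y = x + (t - 1) *\<^sub>R c" and t: "1 \<le> t"
    using assms by (auto simp: dominated_def)
  have "y = (1 / t) *\<^sub>R (t *\<^sub>R y)" using t by simp
  also have "\<dots> = (1 / t) *\<^sub>R x + ((t - 1) / t) *\<^sub>R c"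
    unfolding c(2) by (simp add: scaleR_right_distrib)
  also have "\<dots> = (1 - (t - 1) / t) *\<^sub>R x + ((t - 1) / t) *\<^sub>R c"
    using t by (simp add: diff_divide_distrib)
  also have "\<dots> \<in> D"
    by (rule open_segment_subset_open_convex[OF open_D convex_D assms(2) c(1)])
       (use t in \<open>auto simp: field_simps\<close>)
  finally show ?thesis .
qed

section \<open>Exit points and the order ratio as least constant of domination\<close>

text \<open>The parameters at which the ray is in the closure form a closed bounded set. Its
  supremum gives the exit point, since at a point of the open set \<open>D\<close> the ray could be
  continued.\<close>

lemma exit_point_exists:
  assumes "x \<in> D" "y \<in> D" "x \<noteq> y"
  obtains b s where "s > 0" "b \<in> closure D - D" "b = y + s *\<^sub>R (y - x)"
proof -
  define f where "f s = y + s *\<^sub>R (y - x)" for s :: real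
  define T where "T = {s. 0 \<le> s \<and> f s \<in> closure D}"
  have cf: "continuous_on UNIV f" unfolding f_def by (intro continuous_intros)
  have "T = {0..} \<inter> f -` closure D" by (auto simp: T_def)
  then have clT: "closed T" using cf
    by (metis closed_Int closed_atLeast closed_closure closed_vimage)
  obtain R where R: "\<And>z. z \<in> closure D \<Longrightarrow> norm z \<le> R"
    using bounded_D bounded_closure bounded_iff by metis
  have bd: "s \<le> 2 * R / norm (y - x)" if "s \<in> T" for s
  proof -
    have "s * norm (y - x) = norm (f s - y)" using that by (simp add: f_def T_def)
    also have "\<dots> \<le> 2 * R"
      using R[of "f s"] R[of y] that in_closure[OF assms(2)] norm_triangle_ineq4[of "f s" y]
      by (simp add: T_def)
    finally show ?thesis using assms by (simp add: field_simps)
  qed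
  have T0: "0 \<in> T" using assms in_closure by (simp add: T_def f_def)
  have bdT: "bdd_above T" using bd by (auto simp: bdd_above_def)
  define s where "s = Sup T"
  have sT: "s \<in> T" unfolding s_def using closed_contains_Sup[OF _ bdT clT] T0 by blast
  have "f s \<notin> D"
  proof
    assume "f s \<in> D"
    moreover have "open (f -` D)" using cf open_D open_vimage by blast
    ultimately obtain e where e: "e > 0" "ball s e \<subseteq> f -` D"
      by (metis openE vimageI)
    have "s + e / 2 \<in> ball s e" using e by (simp add: dist_real_def)
    then have "s + e / 2 \<in> T" using e sT in_closure by (auto simp: T_def)
    then have "s + e / 2 \<le> s" unfolding s_def by (rule cSup_upper[OF _ bdT])
    then show False using e by simp
  qed
  moreover from this have "s \<noteq> 0" using assms by (auto simp: f_def)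
  ultimately show ?thesis using that[of s "f s"] sT by (auto simp: T_def f_def)
qed

text \<open>The nearer of two boundary points would lie strictly between the interior point
  \<open>y\<close> and the farther one, hence in \<open>D\<close>.\<close>

lemma boundary_ray_unique:
  assumes "y \<in> D" "0 < s" "0 < s'" "y + s *\<^sub>R v \<in> closure D - D" "y + s' *\<^sub>R v \<in> closure D - D"
  shows "s = s'"
proof -
  have *: False if "0 < s" "s < s'" "y + s *\<^sub>R v \<in> closure D - D" "y + s' *\<^sub>R v \<in> closure D" for s s'
  proof -
    have "(1 - s / s') *\<^sub>R y + (s / s') *\<^sub>R (y + s' *\<^sub>R v) \<in> D"
      by (rule open_segment_subset_open_convex[OF open_D convex_D assms(1) that(4)])
         (use that in auto)
    moreover have "(1 - s / s') *\<^sub>R y + (s / s') *\<^sub>R (y + s' *\<^sub>R v) = y + s *\<^sub>R v"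
      using that by (simp add: algebra_simps)
    ultimately show False using that by simp
  qed
  show ?thesis using *[of s s'] *[of s' s] assms by (cases s s' rule: linorder_cases) auto
qed

lemma exit_point_eq:
  assumes "x \<in> D" "y \<in> D" "x \<noteq> y" "s > 0" "y + s *\<^sub>R (y - x) \<in> closure D - D"
  shows "exit_point D x y = y + s *\<^sub>R (y - x)"
  unfolding exit_point_def
proof (rule the_equality)
  let ?b = "y + s *\<^sub>R (y - x)"
  have "y = (1 - 1 / (1 + s)) *\<^sub>R x + (1 / (1 + s)) *\<^sub>R ?b"
  proof -
    have "(1 + s) * (1 - 1 / (1 + s)) = s" "(1 + s) * (1 / (1 + s)) = 1"
      using assms(4) by (simp_all add: field_simps)
    then have "(1 + s) *\<^sub>R ((1 - 1 / (1 + s)) *\<^sub>R x + (1 / (1 + s)) *\<^sub>R ?b) = s *\<^sub>R x + ?b"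
      by (simp only: scaleR_right_distrib[of "1 + s"] scaleR_scaleR scaleR_one)
    also have "\<dots> = (1 + s) *\<^sub>R y" by (simp add: algebra_simps)
    finally show ?thesis using assms(4)
      by (metis add_pos_pos less_numeral_extra(1) order_less_irrefl scaleR_left_imp_eq)
  qed
  moreover have "x \<noteq> ?b" using assms by auto
  ultimately have "y \<in> open_segment x ?b" unfolding in_segment
    by (intro conjI exI[of _ "1 / (1 + s)"]) (use assms in auto)
  then show "?b \<in> closure D - D \<and> y \<in> open_segment x ?b" using assms by blast
next
  fix b assume b: "b \<in> closure D - D \<and> y \<in> open_segment x b"
  then obtain u where u: "0 < u" "u < 1" "y = (1 - u) *\<^sub>R x + u *\<^sub>R b"
    unfolding in_segment by blast
  \<comment> \<open>Solving \<open>y = (1 - u) x + u b\<close> for \<open>b\<close> gives this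
    parameter on the ray.\<close>
  define s' where "s' = (1 - u) / u"
  have ub: "u *\<^sub>R b = u *\<^sub>R (y + s' *\<^sub>R (y - x))"
  proof -
    have "u *\<^sub>R (y + s' *\<^sub>R (y - x)) = u *\<^sub>R y + (1 - u) *\<^sub>R (y - x)"
      using u(1) by (simp add: s'_def scaleR_right_distrib)
    also have "\<dots> = y - (1 - u) *\<^sub>R x" by (simp add: algebra_simps)
    also have "\<dots> = u *\<^sub>R b" by (subst u(3)) simp
    finally show ?thesis by (rule sym)
  qed
  have "b = y + s' *\<^sub>R (y - x)"
    by (rule scaleR_left_imp_eq[OF _ ub]) (use u(1) in simp)
  moreover have "s' > 0" using u by (simp add: s'_def)
  ultimately show "b = y + s *\<^sub>R (y - x)"
    using boundary_ray_unique[OF assms(2), of s s' "y - x"] assms b by auto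
qed

text \<open>With \<open>b = y + s (y - x)\<close> the ratio is \<open>(1 + s) / s\<close>, and the
  exit point \<open>b\<close> is itself the witness of domination. That this witness is not in
  \<open>D\<close> yields minimality and strict contraction below.\<close>

lemma order_ratio_attained:
  assumes "x \<in> D" "y \<in> D" "x \<noteq> y"
  obtains b where "order_ratio D x y > 1" "b \<in> closure D - D"
    "order_ratio D x y *\<^sub>R y = x + (order_ratio D x y - 1) *\<^sub>R b"
proof -
  obtain b s where bs: "s > 0" "b \<in> closure D - D" "b = y + s *\<^sub>R (y - x)"
    using exit_point_exists[OF assms] .
  then have e: "exit_point D x y = b" using exit_point_eq[OF assms, of s] by simp
  have "x - b = (- (1 + s)) *\<^sub>R (y - x)" "y - b = (- s) *\<^sub>R (y - x)"
    using bs by (simp_all add: algebra_simps)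
  then have "norm (x - b) = (1 + s) * norm (y - x)" "norm (y - b) = s * norm (y - x)"
    using bs(1) by (simp_all only: norm_scaleR)
  then have o: "order_ratio D x y = (1 + s) / s"
    using assms(3) e by (simp add: order_ratio_def)
  have o1: "(1 + s) / s - 1 = 1 / s" using bs(1) by (simp add: field_simps)
  have "x + (1 / s) *\<^sub>R b = x + ((1 / s) *\<^sub>R y + (y - x))"
    using bs(1) by (simp add: bs(3) scaleR_right_distrib)
  also have "\<dots> = ((1 + s) / s) *\<^sub>R y"
    using bs(1) by (simp add: add_divide_distrib scaleR_left_distrib)
  finally show ?thesis using that[of b] bs o o1 by simp
qed

lemma order_ratio_ge_1:
  assumes "x \<in> D" "y \<in> D"
  shows "1 \<le> order_ratio D x y"
proof (cases "x = y")
  case False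
  then show ?thesis by (rule order_ratio_attained[OF assms]) simp
qed (simp add: order_ratio_def)

lemma order_ratio_pos: "x \<in> D \<Longrightarrow> y \<in> D \<Longrightarrow> 0 < order_ratio D x y"
  using order_ratio_ge_1[of x y] by simp

lemma order_ratio_dominated:
  assumes "x \<in> D" "y \<in> D"
  shows "dominated D (order_ratio D x y) x y"
proof (cases "x = y")
  case True
  then show ?thesis using dominated_refl[OF in_closure[OF assms(1)]] by (simp add: order_ratio_def)
next
  case False
  show ?thesis
    by (rule order_ratio_attained[OF assms False]) (auto simp: dominated_def intro: less_imp_le)
qed

text \<open>If \<open>t\<close> were smaller than the ratio \<open>m\<close>, then \<open>b\<close>
  would be a combination of \<open>y\<close> and \<open>c\<close> with positive weight on the
  interior point \<open>y\<close>, hence would lie in \<open>D\<close>.\<close>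

lemma order_ratio_le:
  assumes "x \<in> D" "y \<in> D" "dominated D t x y"
  shows "order_ratio D x y \<le> t"
proof (cases "x = y")
  case True
  then show ?thesis using dominated_ge_1[OF assms(3)] by (simp add: order_ratio_def)
next
  case False
  define m where "m = order_ratio D x y"
  obtain b where b: "m > 1" "b \<in> closure D - D" "m *\<^sub>R y = x + (m - 1) *\<^sub>R b"
    using order_ratio_attained[OF assms(1,2) False] unfolding m_def by metis
  obtain c where c: "c \<in> closure D" "t *\<^sub>R y = x + (t - 1) *\<^sub>R c" and t: "1 \<le> t"
    using assms by (auto simp: dominated_def)
  have "t \<noteq> 1" using c(2) False by auto
  then have t1: "t > 1" using t by simp
  show ?thesis
  proof (rule ccontr)
    assume "\<not> ?thesis"
    then have tm: "t < m" by (simp add: m_def)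
    have "(m - 1) *\<^sub>R b = (m - t) *\<^sub>R y + (t - 1) *\<^sub>R c"
      using b(3) c(2) by (simp add: algebra_simps)
    moreover have "(m - 1) * (1 - (t - 1) / (m - 1)) = m - t" "(m - 1) * ((t - 1) / (m - 1)) = t - 1"
      using b(1) by (simp_all add: field_simps)
    then have "(m - 1) *\<^sub>R ((1 - (t - 1) / (m - 1)) *\<^sub>R y + ((t - 1) / (m - 1)) *\<^sub>R c)
        = (m - t) *\<^sub>R y + (t - 1) *\<^sub>R c"
      by (simp only: scaleR_right_distrib[of "m - 1"] scaleR_scaleR)
    ultimately have "b = (1 - (t - 1) / (m - 1)) *\<^sub>R y + ((t - 1) / (m - 1)) *\<^sub>R c"
      using b(1) by (metis diff_gt_0_iff_gt order_less_irrefl scaleR_left_imp_eq)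
    also have "\<dots> \<in> D"
      by (rule open_segment_subset_open_convex[OF open_D convex_D assms(2) c(1)])
         (use t1 tm in auto)
    finally show False using b by simp
  qed
qed

section \<open>The Hilbert distance as a metric, and its relation to the norm\<close>

text \<open>The cross-ratio factors into one quotient for each exit point.\<close>

lemma hilbert_dist_eq_ln:
  assumes "x \<in> D" "y \<in> D"
  shows "hilbert_dist D x y = ln (order_ratio D x y * order_ratio D y x)"
  by (simp add: hilbert_dist_def order_ratio_def Let_def mult.commute)

lemma hilbert_dist_commute: "x \<in> D \<Longrightarrow> y \<in> D \<Longrightarrow> hilbert_dist D x y = hilbert_dist D y x"
  by (simp add: hilbert_dist_eq_ln mult.commute)

lemma exp_hilbert_dist:
  assumes "x \<in> D" "y \<in> D"
  shows "exp (hilbert_dist D x y) = order_ratio D x y * order_ratio D y x"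
  using order_ratio_ge_1[OF assms] order_ratio_ge_1[OF assms(2,1)]
  by (simp add: hilbert_dist_eq_ln[OF assms])

lemma order_ratio_le_exp:
  assumes "x \<in> D" "y \<in> D"
  shows "order_ratio D x y \<le> exp (hilbert_dist D x y)"
  unfolding exp_hilbert_dist[OF assms]
  using order_ratio_ge_1[OF assms] order_ratio_ge_1[OF assms(2,1)] by simp

lemma hilbert_dist_nonneg:
  assumes "x \<in> D" "y \<in> D"
  shows "0 \<le> hilbert_dist D x y"
  using order_trans[OF order_ratio_ge_1[OF assms] order_ratio_le_exp[OF assms]] by simp

lemma hilbert_dist_pos:
  assumes "x \<in> D" "y \<in> D" "x \<noteq> y"
  shows "0 < hilbert_dist D x y"
proof -
  obtain "order_ratio D x y > 1" using order_ratio_attained[OF assms] .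
  from less_le_trans[OF this order_ratio_le_exp[OF assms(1,2)]] show ?thesis by simp
qed

lemma order_ratio_triangle:
  assumes "x \<in> D" "y \<in> D" "z \<in> D"
  shows "order_ratio D x z \<le> order_ratio D x y * order_ratio D y z"
  by (rule order_ratio_le[OF assms(1,3) dominated_trans[OF order_ratio_dominated order_ratio_dominated]])
    (use assms in auto)

lemma hilbert_dist_triangle:
  assumes "x \<in> D" "y \<in> D" "z \<in> D"
  shows "hilbert_dist D x z \<le> hilbert_dist D x y + hilbert_dist D y z"
proof -
  have "exp (hilbert_dist D x z) \<le>
      (order_ratio D x y * order_ratio D y z) * (order_ratio D z y * order_ratio D y x)"
    unfolding exp_hilbert_dist[OF assms(1,3)]
    by (intro mult_mono order_ratio_triangle assms mult_nonneg_nonneg less_imp_le[OF order_ratio_pos])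
  also have "\<dots> = exp (hilbert_dist D x y + hilbert_dist D y z)"
    by (simp add: exp_add exp_hilbert_dist assms)
  finally show ?thesis by simp
qed

text \<open>The equation \<open>m y = x + (m - 1) b\<close> gives
  \<open>x - y = (m - 1) (y - b)\<close>, where \<open>y - b\<close> is bounded and \<open>m\<close>
  is at most the exponential of the distance.\<close>

lemma norm_le_hilbert_dist:
  obtains R where "R \<ge> 0"
    "\<And>x y. x \<in> D \<Longrightarrow> y \<in> D \<Longrightarrow> norm (x - y) \<le> R * (exp (hilbert_dist D x y) - 1)"
proof -
  obtain R0 where R0: "\<And>z. z \<in> closure D \<Longrightarrow> norm z \<le> R0"
    using bounded_D bounded_closure bounded_iff by metis
  define R where "R = max 0 (2 * R0)"
  have R: "norm (p - q) \<le> R" if "p \<in> closure D" "q \<in> closure D" for p q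
    using R0[OF that(1)] R0[OF that(2)] norm_triangle_ineq4[of p q] by (simp add: R_def)
  have "norm (x - y) \<le> R * (exp (hilbert_dist D x y) - 1)" if xy: "x \<in> D" "y \<in> D" for x y
  proof -
    define m where "m = order_ratio D x y"
    obtain b where b: "b \<in> closure D" "m *\<^sub>R y = x + (m - 1) *\<^sub>R b" and m: "m \<ge> 1"
      using order_ratio_dominated[OF xy] by (auto simp: dominated_def m_def)
    have "x - y = (m - 1) *\<^sub>R (y - b)" using b(2) by (simp add: algebra_simps)
    then have "norm (x - y) = (m - 1) * norm (y - b)" using m by simp
    also have "\<dots> \<le> (exp (hilbert_dist D x y) - 1) * R"
      using R[OF in_closure[OF xy(2)] b(1)] order_ratio_le_exp[OF xy] m hilbert_dist_nonneg[OF xy]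
      by (intro mult_mono) (auto simp: m_def)
    finally show ?thesis by (simp add: mult.commute)
  qed
  then show ?thesis using that[of R] by (simp add: R_def)
qed

text \<open>Perturb the trivial domination of \<open>y\<close> by itself.\<close>

lemma order_ratio_near:
  assumes "u \<in> D" "y \<in> D" "cball y r \<subseteq> closure D" "r > 0"
  shows "order_ratio D u y \<le> 1 + norm (u - y) / r"
proof -
  have "dominated D 1 y y" using assms(2) in_closure dominated_refl by blast
  from dominated_perturb[OF this this assms(3,4), of u]
  have "dominated D (1 + norm (u - y) / r) u y"
    using assms(2) in_closure by (simp add: norm_minus_commute)
  then show ?thesis by (rule order_ratio_le[OF assms(1,2)])
qed

lemma cball_in_closure:
  assumes "x \<in> D"
  obtains r where "r > 0" "cball x r \<subseteq> closure D"
proof -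
  obtain r where "r > 0" "cball x r \<subseteq> D" using open_D assms open_contains_cball_eq by blast
  then show ?thesis using that closure_subset by blast
qed

lemma hilbert_dist_tendsto_0:
  assumes "y \<in> D" "(u \<longlongrightarrow> y) F" "\<forall>\<^sub>F n in F. u n \<in> D"
  shows "((\<lambda>n. hilbert_dist D (u n) y) \<longlongrightarrow> 0) F"
proof -
  obtain r where r: "r > 0" "cball y r \<subseteq> closure D" using cball_in_closure[OF assms(1)] .
  define B where "B n = ln ((1 + norm (u n - y) / (r / 2)) * (1 + norm (u n - y) / (r / 2)))" for n
  have "\<forall>\<^sub>F n in F. dist (u n) y < r / 2" using assms(2) r tendstoD half_gt_zero by blast
  then have "\<forall>\<^sub>F n in F. norm (hilbert_dist D (u n) y) \<le> B n"
    using assms(3)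
  proof eventually_elim
    case (elim n)
    have "cball (u n) (r / 2) \<subseteq> cball y r"
    proof
      fix v assume "v \<in> cball (u n) (r / 2)"
      then show "v \<in> cball y r" using elim(1) dist_triangle3[of y v "u n"] by simp
    qed
    then have 1: "order_ratio D y (u n) \<le> 1 + norm (u n - y) / (r / 2)"
      using order_ratio_near[OF assms(1) elim(2), of "r / 2"] r by (simp add: norm_minus_commute)
    have "cball y (r / 2) \<subseteq> cball y r" using r by (intro subset_cball) simp
    then have 2: "order_ratio D (u n) y \<le> 1 + norm (u n - y) / (r / 2)"
      using order_ratio_near[OF elim(2) assms(1), of "r / 2"] r by simp
    have ge: "1 \<le> order_ratio D y (u n)" "1 \<le> order_ratio D (u n) y"
      using order_ratio_ge_1 elim(2) assms(1) by auto
    have "hilbert_dist D (u n) y \<le> B n"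
      unfolding hilbert_dist_eq_ln[OF elim(2) assms(1)] B_def
      using 1 2 ge by (intro ln_mono mult_mono) (auto intro!: mult_pos_pos)
    then show ?case using hilbert_dist_nonneg[OF elim(2) assms(1)] by simp
  qed
  moreover from r have "(B \<longlongrightarrow> ln ((1 + norm (y - y) / (r / 2)) * (1 + norm (y - y) / (r / 2)))) F"
    unfolding B_def by (intro tendsto_intros assms) auto
  then have "(B \<longlongrightarrow> 0) F" by simp
  ultimately show ?thesis by (rule Lim_null_comparison)
qed

lemma hilbert_dist_tendsto:
  assumes "x \<in> D" "y \<in> D" "(u \<longlongrightarrow> x) F" "(v \<longlongrightarrow> y) F"
    "\<forall>\<^sub>F n in F. u n \<in> D" "\<forall>\<^sub>F n in F. v n \<in> D"
  shows "((\<lambda>n. hilbert_dist D (u n) (v n)) \<longlongrightarrow> hilbert_dist D x y) F"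
proof (rule LIM_zero_cancel, rule Lim_null_comparison)
  show "((\<lambda>n. hilbert_dist D (u n) x + hilbert_dist D (v n) y) \<longlongrightarrow> 0) F"
    using tendsto_add[OF hilbert_dist_tendsto_0[OF assms(1,3,5)] hilbert_dist_tendsto_0[OF assms(2,4,6)]]
    by simp
  show "\<forall>\<^sub>F n in F. norm (hilbert_dist D (u n) (v n) - hilbert_dist D x y)
      \<le> hilbert_dist D (u n) x + hilbert_dist D (v n) y"
    using assms(5,6)
  proof eventually_elim
    case (elim n)
    have "hilbert_dist D (u n) (v n) \<le> hilbert_dist D (u n) x + hilbert_dist D x (v n)"
      "hilbert_dist D x (v n) \<le> hilbert_dist D x y + hilbert_dist D y (v n)"
      "hilbert_dist D x y \<le> hilbert_dist D x (u n) + hilbert_dist D (u n) y"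
      "hilbert_dist D (u n) y \<le> hilbert_dist D (u n) (v n) + hilbert_dist D (v n) y"
      using hilbert_dist_triangle assms(1,2) elim by auto
    then show ?case
      using hilbert_dist_commute[OF assms(1) elim(1)] hilbert_dist_commute[OF assms(2) elim(2)]
      unfolding real_norm_def abs_le_iff by linarith
  qed
qed

section \<open>Strict contraction towards an interior point\<close>

lemma shrink_closure:
  assumes "x \<in> D" "c \<in> closure D" "0 < s" "s < 1"
  shows "(1 - s) *\<^sub>R x + s *\<^sub>R c \<in> D"
  by (rule open_segment_subset_open_convex[OF open_D convex_D assms(1,2)]) (use assms in auto)

text \<open>The affine contraction towards \<open>x\<close> preserves the equation of domination but
  sends the boundary witness \<open>b\<close> to an interior point \<open>c\<close>. The least
  constant is attained with a boundary witness, so it must be smaller.\<close>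

lemma order_ratio_shrink:
  assumes "x \<in> D" "a \<in> D" "a' \<in> D" "a \<noteq> a'" "0 < s" "s < 1"
  shows "order_ratio D ((1 - s) *\<^sub>R x + s *\<^sub>R a) ((1 - s) *\<^sub>R x + s *\<^sub>R a') < order_ratio D a a'"
    (is "order_ratio D ?g ?g' < _")
proof -
  define m where "m = order_ratio D a a'"
  obtain b where b: "m > 1" "b \<in> closure D - D" "m *\<^sub>R a' = a + (m - 1) *\<^sub>R b"
    using order_ratio_attained[OF assms(2,3,4)] unfolding m_def by metis
  define c where "c = (1 - s) *\<^sub>R x + s *\<^sub>R b"
  have c: "c \<in> D" unfolding c_def using shrink_closure assms b by blast
  have g: "?g \<in> D" "?g' \<in> D" using shrink_closure assms in_closure by auto
  have "m *\<^sub>R ?g' = (m * (1 - s)) *\<^sub>R x + s *\<^sub>R (m *\<^sub>R a')" by (simp add: algebra_simps)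
  also have "\<dots> = ?g + (m - 1) *\<^sub>R c" unfolding b(3) c_def by (simp add: algebra_simps)
  finally have eq: "m *\<^sub>R ?g' = ?g + (m - 1) *\<^sub>R c" .
  have "dominated D m ?g ?g'" using eq b(1) in_closure[OF c] unfolding dominated_def by auto
  then have le: "order_ratio D ?g ?g' \<le> m" using order_ratio_le g by blast
  have "?g \<noteq> ?g'" using assms by simp
  from order_ratio_attained[OF g this] obtain b' where b': "b' \<in> closure D - D"
    "order_ratio D ?g ?g' *\<^sub>R ?g' = ?g + (order_ratio D ?g ?g' - 1) *\<^sub>R b'" by metis
  have "order_ratio D ?g ?g' \<noteq> m"
  proof
    assume m: "order_ratio D ?g ?g' = m"
    have "?g + (m - 1) *\<^sub>R b' = ?g + (m - 1) *\<^sub>R c"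
      by (rule trans[OF b'(2)[unfolded m, symmetric] eq])
    then have "(m - 1) *\<^sub>R b' = (m - 1) *\<^sub>R c" by (rule add_left_imp_eq)
    then show False using b(1) b'(1) c by simp
  qed
  with le show ?thesis by (simp add: m_def)
qed

lemma hilbert_dist_shrink:
  assumes "x \<in> D" "a \<in> D" "a' \<in> D" "a \<noteq> a'" "0 < s" "s < 1"
  shows "hilbert_dist D ((1 - s) *\<^sub>R x + s *\<^sub>R a) ((1 - s) *\<^sub>R x + s *\<^sub>R a') < hilbert_dist D a a'"
    (is "hilbert_dist D ?g ?g' < _")
proof -
  have g: "?g \<in> D" "?g' \<in> D" using shrink_closure assms in_closure by auto
  have "exp (hilbert_dist D ?g ?g') < exp (hilbert_dist D a a')"
    unfolding exp_hilbert_dist[OF g] exp_hilbert_dist[OF assms(2,3)]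
    by (intro mult_strict_mono order_ratio_shrink)
       (use assms g order_ratio_pos[OF assms(2,3)] order_ratio_pos[OF g(2,1)] in auto)
  then show ?thesis by simp
qed

section \<open>Absorbed sets of a sequence\<close>

text \<open>
  The points at which the functions \<open>order_ratio D \<cdot> (y n) / order_ratio D x (y n)\<close> tend to \<open>0\<close>.
  Using \<open>dominated\<close> instead of \<open>order_ratio\<close> extends these functions to the boundary.
\<close>

definition absorbed :: "'a \<Rightarrow> (nat \<Rightarrow> 'a) \<Rightarrow> 'a set" where
  "absorbed x y = {u \<in> closure D.
     \<forall>e>0. \<forall>\<^sub>F n in sequentially. dominated D (e * order_ratio D x (y n)) u (y n)}"

lemma convex_absorbed: "convex (absorbed x y)"
proof (rule convexI)
  fix u u' and a b :: real
  assume u: "u \<in> absorbed x y" "u' \<in> absorbed x y" and ab: "0 \<le> a" "0 \<le> b" "a + b = 1"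
  have "\<forall>\<^sub>F n in sequentially. dominated D (e * order_ratio D x (y n)) (a *\<^sub>R u + b *\<^sub>R u') (y n)"
    if "e > 0" for e
  proof -
    have "\<forall>\<^sub>F n in sequentially. dominated D (e * order_ratio D x (y n)) u (y n)"
      "\<forall>\<^sub>F n in sequentially. dominated D (e * order_ratio D x (y n)) u' (y n)"
      using u that by (auto simp: absorbed_def)
    then show ?thesis
    proof eventually_elim
      case (elim n)
      from dominated_convex[OF elim ab] show ?case
        using ab by (simp flip: distrib_right)
    qed
  qed
  then show "a *\<^sub>R u + b *\<^sub>R u' \<in> absorbed x y"
    using u ab convexD[OF convex_closure_D, of u u' a b] by (simp add: absorbed_def)
qed

text \<open>For \<open>u\<close> in \<open>D\<close> the triangle inequality bounds the quotient of
  the ratios of \<open>u\<close> and \<open>x\<close> below by \<open>1 / m\<close>, so it cannot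
  tend to 0; the factor \<open>1 / (2 * m)\<close> gives the contradiction.\<close>

lemma absorbed_disjoint:
  assumes "x \<in> D" "\<And>n. y n \<in> D"
  shows "absorbed x y \<inter> D = {}"
proof (rule ccontr)
  assume "\<not> ?thesis"
  then obtain u where u: "u \<in> absorbed x y" "u \<in> D" by blast
  define m where "m = order_ratio D x u"
  have m: "m \<ge> 1" using assms(1) u(2) order_ratio_ge_1 by (simp add: m_def)
  have "\<forall>\<^sub>F n in sequentially. dominated D (1 / (2 * m) * order_ratio D x (y n)) u (y n)"
    using u m by (simp add: absorbed_def del: times_divide_eq_left)
  then obtain n where "dominated D (1 / (2 * m) * order_ratio D x (y n)) u (y n)"
    using eventually_happens'[OF sequentially_bot] by blast
  then have "order_ratio D u (y n) \<le> 1 / (2 * m) * order_ratio D x (y n)"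
    using order_ratio_le assms(2) u(2) by blast
  then have "m * order_ratio D u (y n) \<le> order_ratio D x (y n) / 2"
    using m by (simp add: field_simps)
  moreover have "order_ratio D x (y n) \<le> m * order_ratio D u (y n)"
    unfolding m_def using order_ratio_triangle assms u(2) by blast
  ultimately show False using order_ratio_ge_1[OF assms(1) assms(2)[of n]] by simp
qed

text \<open>Ratios bounded along infinitely many indices would pass to the limit, so
  \<open>z\<close> would dominate the interior point \<open>x\<close> and lie in
  \<open>D\<close>.\<close>

lemma order_ratio_at_top:
  assumes "x \<in> D" "\<And>n. y n \<in> D" "y \<longlonglongrightarrow> z" "z \<notin> D"
  shows "filterlim (\<lambda>n. order_ratio D x (y n)) at_top sequentially"
  unfolding filterlim_at_top
proof (rule allI, rule ccontr)
  fix Z :: real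
  assume "\<not> (\<forall>\<^sub>F n in sequentially. Z \<le> order_ratio D x (y n))"
  then have "\<exists>\<^sub>F n in sequentially. order_ratio D x (y n) < Z"
    by (simp add: not_eventually not_le)
  \<comment> \<open>The maximum with 2 supplies the constant above 1 on which
    \<open>dominated_limit\<close> relies.\<close>
  then have "\<exists>\<^sub>F n in sequentially. dominated D (max Z 2) x (y n)"
    by (rule frequently_elim1)
       (rule dominated_mono, rule order_ratio_dominated, use assms in_closure in auto)
  then have "dominated D (max Z 2) x z"
    using dominated_limit[of "max Z 2" "\<lambda>_. x" x y z] assms(3) by simp
  then show False using dominated_interior assms by blast
qed

text \<open>Moving \<open>u\<close> to \<open>z\<close> costs at most
  \<open>norm (u - z) / r\<close> times the normalising ratio, which is small on the scale of
  \<open>absorbed\<close>.\<close>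

lemma absorbed_approx:
  assumes "x \<in> D" "\<And>n. y n \<in> D" "z \<in> closure D"
    and "\<And>e. e > 0 \<Longrightarrow> \<exists>u. norm (u - z) < e \<and>
      (\<forall>\<^sub>F n in sequentially. dominated D (e * order_ratio D x (y n)) u (y n))"
  shows "z \<in> absorbed x y"
proof -
  obtain r where r: "r > 0" "cball x r \<subseteq> closure D" using cball_in_closure[OF assms(1)] .
  have "\<forall>\<^sub>F n in sequentially. dominated D (e * order_ratio D x (y n)) z (y n)" if e: "e > 0" for e
  proof -
    \<comment> \<open>One half of \<open>e\<close> is spent on the domination of \<open>u\<close>,
      the other on the perturbation to \<open>z\<close>.\<close>
    define k where "k = min (e / 2) (e * r / 2)"
    have "k > 0" using r e by (simp add: k_def)
    then obtain u where u: "norm (u - z) < k"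
      "\<forall>\<^sub>F n in sequentially. dominated D (k * order_ratio D x (y n)) u (y n)"
      using assms(4) by blast
    from u(2) show ?thesis
    proof eventually_elim
      case (elim n)
      let ?m = "order_ratio D x (y n)"
      have m: "?m \<ge> 1" using order_ratio_ge_1 assms by blast
      have *: "dominated D (k * ?m + norm (u - z) / r * ?m) z (y n)"
        by (rule dominated_perturb[OF elim order_ratio_dominated[OF assms(1,2)] r(2,1)
              in_closure[OF assms(2)]])
      have "norm (u - z) / r \<le> e / 2" using u(1) r by (simp add: k_def field_simps)
      moreover have "k \<le> e / 2" by (simp add: k_def)
      ultimately have "(k + norm (u - z) / r) * ?m \<le> e * ?m"
        using m by (intro mult_right_mono) linarith+
      then show ?case
        using dominated_mono[OF *, of "e * ?m"] in_closure[OF assms(2)]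
        by (simp add: distrib_right)
    qed
  qed
  then show ?thesis using assms(3) by (simp add: absorbed_def)
qed

text \<open>Since \<open>y n\<close> dominates itself with constant 1, it dominates \<open>z\<close>
  with 1 plus a vanishing multiple of the normalising ratio; the 1 is negligible because that ratio
  tends to infinity.\<close>

lemma limit_in_absorbed:
  assumes "x \<in> D" "\<And>n. y n \<in> D" "y \<longlonglongrightarrow> z" "z \<notin> D" "z \<in> closure D"
  shows "z \<in> absorbed x y"
proof -
  obtain r where r: "r > 0" "cball x r \<subseteq> closure D" using cball_in_closure[OF assms(1)] .
  have "\<forall>\<^sub>F n in sequentially. dominated D (e * order_ratio D x (y n)) z (y n)" if e: "e > 0" for e
  proof -
    have "\<forall>\<^sub>F n in sequentially. dist (y n) z < e * r / 2"
      using assms(3) e r by (intro tendstoD) auto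
    moreover have "\<forall>\<^sub>F n in sequentially. 2 / e \<le> order_ratio D x (y n)"
      using order_ratio_at_top[OF assms(1-4)] by (simp add: filterlim_at_top)
    ultimately show ?thesis
    proof eventually_elim
      case (elim n)
      let ?m = "order_ratio D x (y n)"
      have m: "?m \<ge> 1" using order_ratio_ge_1 assms by blast
      have *: "dominated D (1 + norm (y n - z) / r * ?m) z (y n)"
        by (rule dominated_perturb[OF dominated_refl[OF in_closure[OF assms(2)]]
              order_ratio_dominated[OF assms(1,2)] r(2,1) in_closure[OF assms(2)]])
      have "norm (y n - z) / r \<le> e / 2" using elim r by (simp add: dist_norm field_simps)
      then have "norm (y n - z) / r * ?m \<le> e / 2 * ?m"
        using m by (intro mult_right_mono) auto
      moreover have "1 \<le> e / 2 * ?m" using elim(2) e by (simp add: field_simps)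
      ultimately have "1 + norm (y n - z) / r * ?m \<le> e * ?m" by linarith
      then show ?case
        by (rule dominated_mono[OF * _ in_closure[OF assms(2)]])
    qed
  qed
  then show ?thesis using assms(5) by (simp add: absorbed_def)
qed

text \<open>An absorbed set contains the whole face of each of its points: by transitivity the fixed
  factor \<open>t\<close> is absorbed by \<open>e\<close>.\<close>

lemma absorbed_dominated:
  assumes "z \<in> absorbed x y" "dominated D t u z" "u \<in> closure D"
  shows "u \<in> absorbed x y"
proof -
  have t: "t \<ge> 1" using assms(2) dominated_ge_1 by blast
  have "\<forall>\<^sub>F n in sequentially. dominated D (e * order_ratio D x (y n)) u (y n)" if e: "e > 0" for e
  proof -
    have "\<forall>\<^sub>F n in sequentially. dominated D (e / t * order_ratio D x (y n)) z (y n)"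
      using assms(1) e t by (simp add: absorbed_def del: times_divide_eq_left)
    then show ?thesis
    proof eventually_elim
      case (elim n)
      from dominated_trans[OF assms(2) elim] show ?case using t by simp
    qed
  qed
  then show ?thesis using assms(3) by (simp add: absorbed_def)
qed

end

section \<open>Compactness in a finite-dimensional normed space\<close>

text \<open>Induction on the spanning set. A new vector \<open>b\<close> outside
  \<open>span B\<close> has positive distance from it, so the \<open>b\<close>-coordinates of the
  sequence are bounded, and successive subsequences make both components converge.\<close>

lemma bounded_seq_in_finite_span:
  fixes f :: "nat \<Rightarrow> 'a::real_normed_vector"
  assumes "finite B" "\<And>n. f n \<in> span B" "bounded (range f)"
  shows "\<exists>l\<in>span B. \<exists>r. strict_mono (r :: nat \<Rightarrow> nat) \<and> (f \<circ> r) \<longlonglongrightarrow> l"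
  using assms
proof (induction B arbitrary: f rule: finite_induct)
  case empty
  then have "f \<circ> id = (\<lambda>_. 0)" by (simp add: fun_eq_iff)
  then have "(f \<circ> id) \<longlonglongrightarrow> 0" by simp
  then show ?case using strict_mono_id span_zero by blast
next
  case (insert b B)
  show ?case
  proof (cases "b \<in> span B")
    case True
    then have "span (insert b B) = span B" by (rule span_redundant)
    then show ?thesis using insert.IH[of f] insert.prems by simp
  next
    case False
    \<comment> \<open>A convergent sequence is bounded, so the induction hypothesis puts the limit
      of a subsequence into \<open>span B\<close>.\<close>
    have "closed (span B)"
      unfolding closed_sequential_limits
    proof (intro allI impI)
      fix g :: "nat \<Rightarrow> 'a" and l
      assume g: "(\<forall>n. g n \<in> span B) \<and> g \<longlonglongrightarrow> l"
      then have "bounded (range g)" using convergent_imp_bounded by blast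
      then obtain l' r where l': "l' \<in> span B" "strict_mono (r :: nat \<Rightarrow> nat)" "(g \<circ> r) \<longlonglongrightarrow> l'"
        using insert.IH[of g] g by metis
      have "(g \<circ> r) \<longlonglongrightarrow> l" using g l'(2) by (intro LIMSEQ_subseq_LIMSEQ) auto
      then show "l \<in> span B" using l' LIMSEQ_unique by metis
    qed
    then obtain e where e: "e > 0" "ball b e \<subseteq> - span B"
      using False openE[of "- span B" b] by blast
    have "\<forall>n. \<exists>k. f n - k *\<^sub>R b \<in> span B"
      using insert.prems(1) span_breakdown_eq by blast
    then obtain k where k: "f n - k n *\<^sub>R b \<in> span B" for n
      by metis
    have kb: "\<bar>k n\<bar> * e \<le> norm (f n)" for n
    proof (cases "k n = 0")
      case False
      \<comment> \<open>This vector of \<open>span B\<close> satisfies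
        \<open>b - w = f n / k n\<close>, so the distance \<open>e\<close> from \<open>b\<close> to
        \<open>span B\<close> bounds \<open>k n\<close>.\<close>
      define w where "w = (- 1 / k n) *\<^sub>R (f n - k n *\<^sub>R b)"
      have "w \<in> span B" unfolding w_def by (intro span_scale k)
      then have "e \<le> dist b w" using e by force
      also have "b - w = (1 / k n) *\<^sub>R f n"
        using False by (simp add: w_def scaleR_diff_right)
      then have "dist b w = norm (f n) / \<bar>k n\<bar>" by (simp add: dist_norm)
      finally show ?thesis using False by (simp add: field_simps)
    qed simp
    obtain R where R: "\<And>n. norm (f n) \<le> R" using insert.prems(2) by (auto simp: bounded_iff)
    have "norm (k n) \<le> R / e" for n using kb[of n] R[of n] e by (simp add: field_simps)
    then have "bounded (range k)" by (auto simp: bounded_iff)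
    then obtain l1 r1 where 1: "strict_mono (r1 :: nat \<Rightarrow> nat)" "(k \<circ> r1) \<longlonglongrightarrow> l1"
      using bounded_imp_convergent_subsequence by blast
    define w where "w n = f (r1 n) - k (r1 n) *\<^sub>R b" for n
    have "norm (w n) \<le> R + R / e * norm b" for n
    proof -
      have "norm (w n) \<le> norm (f (r1 n)) + norm (k (r1 n) *\<^sub>R b)"
        unfolding w_def by (rule norm_triangle_ineq4)
      also have "norm (k (r1 n) *\<^sub>R b) \<le> R / e * norm b"
        unfolding norm_scaleR using \<open>norm (k (r1 n)) \<le> R / e\<close>
        by (intro mult_right_mono) auto
      finally show ?thesis using R[of "r1 n"] by simp
    qed
    then have "bounded (range w)" by (auto simp: bounded_iff)
    moreover have "w n \<in> span B" for n using k by (simp add: w_def)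
    ultimately obtain l2 r2 where 2: "l2 \<in> span B" "strict_mono (r2 :: nat \<Rightarrow> nat)" "(w \<circ> r2) \<longlonglongrightarrow> l2"
      using insert.IH by blast
    have "((k \<circ> r1) \<circ> r2) \<longlonglongrightarrow> l1" using 1(2) 2(2) by (rule LIMSEQ_subseq_LIMSEQ)
    then have "(\<lambda>n. (w \<circ> r2) n + ((k \<circ> r1) \<circ> r2) n *\<^sub>R b) \<longlonglongrightarrow> l2 + l1 *\<^sub>R b"
      by (intro tendsto_intros 2)
    moreover have "(\<lambda>n. (w \<circ> r2) n + ((k \<circ> r1) \<circ> r2) n *\<^sub>R b) = f \<circ> (r1 \<circ> r2)"
      by (simp add: w_def fun_eq_iff)
    ultimately have "(f \<circ> (r1 \<circ> r2)) \<longlonglongrightarrow> l2 + l1 *\<^sub>R b" by simp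
    moreover have "l2 + l1 *\<^sub>R b \<in> span (insert b B)"
      using 2(1) unfolding span_breakdown_eq by (intro exI[of _ l1]) simp
    moreover have "strict_mono (r1 \<circ> r2)" using 1(1) 2(2) by (rule strict_mono_o)
    ultimately show ?thesis by blast
  qed
qed

lemma compact_closure_of_finite_span:
  fixes D :: "'a::real_normed_vector set"
  assumes "finite B" "span B = (UNIV :: 'a set)" "bounded D"
  shows "compact (closure D)"
  unfolding compact_def
proof (intro allI impI)
  fix f :: "nat \<Rightarrow> 'a" assume f: "\<forall>n. f n \<in> closure D"
  then have "bounded (range f)"
    using assms(3) bounded_closure bounded_subset by (metis image_subsetI)
  then obtain l and r :: "nat \<Rightarrow> nat" where "strict_mono r" "(f \<circ> r) \<longlonglongrightarrow> l"
    using bounded_seq_in_finite_span[OF assms(1), of f] assms(2) by auto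
  moreover from this have "l \<in> closure D"
    using f closed_sequentially[of "closure D" "f \<circ> r" l] by simp
  ultimately show "\<exists>l\<in>closure D. \<exists>r. strict_mono r \<and> (f \<circ> r) \<longlonglongrightarrow> l" by blast
qed

section \<open>Continuity of \<open>F\<close> and fixed points of its averages\<close>

locale hilbert_nonexpansive_map = bounded_convex_domain D
  for D :: "'a::real_normed_vector set" +
  fixes F :: "'a \<Rightarrow> 'a"
  assumes compact_closure: "compact (closure D)"
    and hilbert_dist_convex: "\<And>x y z w s. \<lbrakk>x \<in> D; y \<in> D; z \<in> D; w \<in> D; s \<in> {0..1}\<rbrakk> \<Longrightarrow>
           hilbert_dist D (s *\<^sub>R x + (1 - s) *\<^sub>R y) (s *\<^sub>R z + (1 - s) *\<^sub>R w)
             \<le> max (hilbert_dist D x z) (hilbert_dist D y w)"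
    and F_in: "\<And>x. x \<in> D \<Longrightarrow> F x \<in> D"
    and nonexpansive: "\<And>x y. x \<in> D \<Longrightarrow> y \<in> D \<Longrightarrow> hilbert_dist D (F x) (F y) \<le> hilbert_dist D x y"
begin

text \<open>Norm convergence in \<open>D\<close> to a point of \<open>D\<close> implies convergence
  in the Hilbert distance, which \<open>F\<close> preserves and which controls the norm.\<close>

lemma F_tendsto:
  assumes "x \<in> D" "(u \<longlongrightarrow> x) G" "\<forall>\<^sub>F n in G. u n \<in> D"
  shows "((\<lambda>n. F (u n)) \<longlongrightarrow> F x) G"
proof -
  obtain R where R: "R \<ge> 0"
    "\<And>x y. x \<in> D \<Longrightarrow> y \<in> D \<Longrightarrow> norm (x - y) \<le> R * (exp (hilbert_dist D x y) - 1)"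
    using norm_le_hilbert_dist by blast
  show ?thesis
  proof (rule LIM_zero_cancel, rule Lim_null_comparison)
    have "((\<lambda>n. R * (exp (hilbert_dist D (u n) x) - 1)) \<longlongrightarrow> R * (exp 0 - 1)) G"
      by (intro tendsto_intros hilbert_dist_tendsto_0 assms)
    then show "((\<lambda>n. R * (exp (hilbert_dist D (u n) x) - 1)) \<longlongrightarrow> 0) G" by simp
    show "\<forall>\<^sub>F n in G. norm (F (u n) - F x) \<le> R * (exp (hilbert_dist D (u n) x) - 1)"
      using assms(3)
    proof eventually_elim
      case (elim n)
      have "norm (F (u n) - F x) \<le> R * (exp (hilbert_dist D (F (u n)) (F x)) - 1)"
        using R(2) F_in elim assms(1) by blast
      also have "\<dots> \<le> R * (exp (hilbert_dist D (u n) x) - 1)"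
        using nonexpansive[OF elim assms(1)] R(1) by (intro mult_left_mono) auto
      finally show ?case .
    qed
  qed
qed

text \<open>
  The map \<open>y \<mapsto> (1 - s) x + s F y\<close> shrinks distances strictly and has its values in a compact
  subset of \<open>D\<close>; a point minimising the displacement there is fixed.
\<close>

lemma averaged_fixed_point_exists:
  assumes "x \<in> D" "0 < s" "s < 1"
  shows "\<exists>z\<in>D. z = (1 - s) *\<^sub>R x + s *\<^sub>R F z"
proof -
  define g where "g c = (1 - s) *\<^sub>R x + s *\<^sub>R c" for c
  define K where "K = g ` closure D"
  have KD: "K \<subseteq> D" using shrink_closure[OF assms(1) _ assms(2,3)] by (auto simp: K_def g_def)
  have gK: "g (F y) \<in> K" if "y \<in> D" for y
    using in_closure[OF F_in[OF that]] by (simp add: K_def)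
  have gD: "g (F y) \<in> D" if "y \<in> D" for y using gK[OF that] KD by blast
  have 1: "compact K" unfolding K_def g_def
    by (intro compact_continuous_image continuous_intros compact_closure)
  have 2: "K \<noteq> {}" using gK assms(1) by blast
  have 3: "continuous_on K (\<lambda>y. hilbert_dist D y (g (F y)))"
    unfolding continuous_on_def
  proof (rule ballI, rule hilbert_dist_tendsto)
    fix y assume y: "y \<in> K"
    have ev: "\<forall>\<^sub>F u in at y within K. u \<in> D"
      unfolding eventually_at_filter using KD by (intro always_eventually) blast
    show "y \<in> D" "g (F y) \<in> D" using y KD gD by auto
    show "((\<lambda>u. u) \<longlongrightarrow> y) (at y within K)" by (rule tendsto_ident_at)
    then show "((\<lambda>u. g (F u)) \<longlongrightarrow> g (F y)) (at y within K)"
      unfolding g_def by (intro tendsto_intros F_tendsto[OF _ _ ev]) (use y KD in auto)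
    show "\<forall>\<^sub>F u in at y within K. u \<in> D" by (rule ev)
    then show "\<forall>\<^sub>F u in at y within K. g (F u) \<in> D" by (rule eventually_mono) (rule gD)
  qed
  obtain y where y: "y \<in> K"
    "\<And>w. w \<in> K \<Longrightarrow> hilbert_dist D y (g (F y)) \<le> hilbert_dist D w (g (F w))"
    using continuous_attains_inf[OF 1 2 3] by blast
  have yD: "y \<in> D" using y KD by blast
  have "y = g (F y)"
  proof (rule ccontr)
    assume ne: "y \<noteq> g (F y)"
    define w where "w = g (F y)"
    have w: "w \<in> K" "w \<in> D" using gK gD yD by (auto simp: w_def)
    have pos: "hilbert_dist D y w > 0" using hilbert_dist_pos[OF yD w(2)] ne by (simp add: w_def)
    have "hilbert_dist D w (g (F w)) < hilbert_dist D y w"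
    \<comment> \<open>Strict contraction requires distinct points; if the \<open>F\<close>-values
      agree, \<open>w\<close> is fixed and its displacement is 0.\<close>
    proof (cases "F y = F w")
      case True
      then have "w = g (F w)" by (simp add: w_def)
      then show ?thesis using pos by (simp add: hilbert_dist_def)
    next
      case False
      have "hilbert_dist D w (g (F w)) < hilbert_dist D (F y) (F w)"
        using hilbert_dist_shrink[OF assms(1) F_in[OF yD] F_in[OF w(2)] False assms(2,3)]
        by (simp add: w_def g_def)
      then show ?thesis using nonexpansive[OF yD w(2)] by simp
    qed
    then show False using y(2)[OF w(1)] by (simp add: w_def)
  qed
  then show ?thesis using yD by (auto simp: g_def)
qed

text \<open>Distinct fixed points have distinct \<open>F\<close>-values, and strict contraction
  would make \<open>F\<close> expand their distance.\<close>

lemma averaged_fixed_point_unique: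
  assumes "x \<in> D" "0 < s" "s < 1" "z \<in> D" "z' \<in> D"
    and "z = (1 - s) *\<^sub>R x + s *\<^sub>R F z" "z' = (1 - s) *\<^sub>R x + s *\<^sub>R F z'"
  shows "z = z'"
proof (rule ccontr)
  assume "z \<noteq> z'"
  then have "F z \<noteq> F z'" using assms(6,7) by metis
  from hilbert_dist_shrink[OF assms(1) F_in[OF assms(4)] F_in[OF assms(5)] this assms(2,3)]
  have "hilbert_dist D z z' < hilbert_dist D (F z) (F z')"
    using assms(6,7) by simp
  then show False using nonexpansive[OF assms(4,5)] by simp
qed

section \<open>Resolvents: defining equation, nonexpansiveness, resolvent identity\<close>

lemma resolvent_ex1:
  assumes "x \<in> D" "l > 0"
  shows "\<exists>!z. z \<in> D \<and> z = (1 / (1 + l)) *\<^sub>R x + (l / (1 + l)) *\<^sub>R F z"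
proof -
  have eq: "1 / (1 + l) = 1 - l / (1 + l)" using assms(2) by (simp add: field_simps)
  have s: "0 < l / (1 + l)" "l / (1 + l) < 1" using assms(2) by auto
  show ?thesis unfolding eq
    using averaged_fixed_point_exists[OF assms(1) s] averaged_fixed_point_unique[OF assms(1) s]
    by blast
qed

abbreviation R :: "real \<Rightarrow> 'a \<Rightarrow> 'a" where "R \<equiv> resolvent D F"

lemma resolvent_is_fixed_point:
  assumes "x \<in> D" "l > 0"
  shows "R l x \<in> D \<and> R l x = (1 / (1 + l)) *\<^sub>R x + (l / (1 + l)) *\<^sub>R F (R l x)"
  unfolding resolvent_def by (rule theI'[OF resolvent_ex1[OF assms]])

lemma resolvent_in: "x \<in> D \<Longrightarrow> l > 0 \<Longrightarrow> R l x \<in> D"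
  using resolvent_is_fixed_point by blast

lemma resolvent_equation:
  assumes "x \<in> D" "l > 0"
  shows "(1 + l) *\<^sub>R R l x = x + l *\<^sub>R F (R l x)"
proof -
  have "(1 + l) *\<^sub>R R l x = (1 + l) *\<^sub>R ((1 / (1 + l)) *\<^sub>R x + (l / (1 + l)) *\<^sub>R F (R l x))"
    using resolvent_is_fixed_point[OF assms] by simp
  also have "\<dots> = x + l *\<^sub>R F (R l x)"
    using assms(2) by (simp add: scaleR_right_distrib)
  finally show ?thesis .
qed

lemma resolvent_unique:
  assumes "x \<in> D" "l > 0" "z \<in> D" "(1 + l) *\<^sub>R z = x + l *\<^sub>R F z"
  shows "R l x = z"
proof -
  have "z = (1 / (1 + l)) *\<^sub>R ((1 + l) *\<^sub>R z)" using assms(2) by simp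
  also have "\<dots> = (1 / (1 + l)) *\<^sub>R x + (l / (1 + l)) *\<^sub>R F z"
    unfolding assms(4) by (simp add: scaleR_right_distrib)
  finally have "z = (1 / (1 + l)) *\<^sub>R x + (l / (1 + l)) *\<^sub>R F z" .
  with assms(3) show ?thesis
    using resolvent_ex1[OF assms(1,2)] resolvent_is_fixed_point[OF assms(1,2)] by (metis (no_types, lifting))
qed

text \<open>
  The convexity hypothesis alone gives only
  \<open>d (R l x) (R l x') \<le> max (d x x') (d (F (R l x)) (F (R l x')))\<close>. If \<open>R l\<close> expanded a distance,
  then pulling both \<open>F\<close>-values slightly towards \<open>x\<close>, and moving \<open>x\<close> and \<open>x'\<close> so that the
  convex combinations stay the same, would make both arguments of the maximum too small.
\<close>

lemma resolvent_nonexpansive: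
  assumes "x \<in> D" "x' \<in> D" "l > 0"
  shows "hilbert_dist D (R l x) (R l x') \<le> hilbert_dist D x x'"
proof (rule ccontr)
  define z z' where "z = R l x" and "z' = R l x'"
  assume "\<not> ?thesis"
  then have gt: "hilbert_dist D x x' < hilbert_dist D z z'" by (simp add: z_def z'_def)
  have z: "z \<in> D" "z' \<in> D" using resolvent_in assms by (auto simp: z_def z'_def)
  have Fz: "F z \<in> D" "F z' \<in> D" using z F_in by auto
  have zeq: "(1 + l) *\<^sub>R z = x + l *\<^sub>R F z" "(1 + l) *\<^sub>R z' = x' + l *\<^sub>R F z'"
    using resolvent_equation assms by (auto simp: z_def z'_def)
  \<comment> \<open>The correction keeps \<open>p \<delta> + l w \<delta>\<close> equal to
    \<open>x + l F z\<close>, and likewise for the primed points. Both \<open>F\<close>-values are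
    pulled towards the same point \<open>x\<close>, so \<open>x\<close> and not \<open>x'\<close> is
    subtracted in \<open>p'\<close>.\<close>
  define p p' where "p \<delta> = x + (l * \<delta>) *\<^sub>R (F z - x)" and "p' \<delta> = x' + (l * \<delta>) *\<^sub>R (F z' - x)"
    for \<delta> :: real
  define w w' where "w \<delta> = (1 - (1 - \<delta>)) *\<^sub>R x + (1 - \<delta>) *\<^sub>R F z"
    and "w' \<delta> = (1 - (1 - \<delta>)) *\<^sub>R x + (1 - \<delta>) *\<^sub>R F z'" for \<delta> :: real
  define s where "s = 1 / (1 + l)"
  have s: "s \<in> {0..1}" "1 - s = s * l" using assms(3) by (auto simp: s_def field_simps)
  have comb: "s *\<^sub>R q + (1 - s) *\<^sub>R v = y" if "(1 + l) *\<^sub>R y = q + l *\<^sub>R v" for q v y :: 'a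
  proof -
    have "s *\<^sub>R q + (1 - s) *\<^sub>R v = s *\<^sub>R (q + l *\<^sub>R v)"
      unfolding s(2) by (simp add: scaleR_right_distrib)
    also have "\<dots> = y" unfolding that[symmetric] s_def using assms(3) by simp
    finally show ?thesis .
  qed
  have c: "s *\<^sub>R p \<delta> + (1 - s) *\<^sub>R w \<delta> = z" "s *\<^sub>R p' \<delta> + (1 - s) *\<^sub>R w' \<delta> = z'" for \<delta>
    by (rule comb, unfold zeq, simp add: p_def w_def p'_def w'_def algebra_simps)+
  have "(p \<longlongrightarrow> x + (l * 0) *\<^sub>R (F z - x)) (at_right 0)"
    unfolding p_def by (intro tendsto_intros)
  then have pt: "(p \<longlongrightarrow> x) (at_right 0)" by simp
  have "(p' \<longlongrightarrow> x' + (l * 0) *\<^sub>R (F z' - x)) (at_right 0)"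
    unfolding p'_def by (intro tendsto_intros)
  then have pt': "(p' \<longlongrightarrow> x') (at_right 0)" by simp
  have pD: "\<forall>\<^sub>F \<delta> in at_right 0. p \<delta> \<in> D" "\<forall>\<^sub>F \<delta> in at_right 0. p' \<delta> \<in> D"
    using topological_tendstoD[OF pt open_D assms(1)] topological_tendstoD[OF pt' open_D assms(2)] .
  \<comment> \<open>By continuity the strict inequality \<open>gt\<close> survives the displacement
    of \<open>x\<close> and \<open>x'\<close> for all small \<open>\<delta>\<close>.\<close>
  have "((\<lambda>\<delta>. hilbert_dist D (p \<delta>) (p' \<delta>)) \<longlongrightarrow> hilbert_dist D x x') (at_right 0)"
    by (intro hilbert_dist_tendsto assms pt pt' pD)
  then have "\<forall>\<^sub>F \<delta> in at_right 0. hilbert_dist D (p \<delta>) (p' \<delta>) < hilbert_dist D z z'"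
    using gt by (rule order_tendstoD)
  moreover have "\<forall>\<^sub>F \<delta> in at_right (0::real). 0 < \<delta> \<and> \<delta> < 1"
    using eventually_at_right_real[of 0 "1::real"] by simp
  ultimately have "\<forall>\<^sub>F \<delta> in at_right 0. p \<delta> \<in> D \<and> p' \<delta> \<in> D \<and>
      hilbert_dist D (p \<delta>) (p' \<delta>) < hilbert_dist D z z' \<and> 0 < \<delta> \<and> \<delta> < 1"
    using pD by eventually_elim auto
  then obtain \<delta> where \<delta>: "p \<delta> \<in> D" "p' \<delta> \<in> D"
      "hilbert_dist D (p \<delta>) (p' \<delta>) < hilbert_dist D z z'" "0 < \<delta>" "\<delta> < 1"
    using eventually_happens'[OF trivial_limit_at_right_real] by blast
  have t: "0 < 1 - \<delta>" "1 - \<delta> < 1" using \<delta> by auto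
  have wD: "w \<delta> \<in> D" "w' \<delta> \<in> D"
    unfolding w_def w'_def using shrink_closure[OF assms(1) in_closure t] Fz by auto
  have le: "hilbert_dist D z z' \<le> max (hilbert_dist D (p \<delta>) (p' \<delta>)) (hilbert_dist D (w \<delta>) (w' \<delta>))"
    using hilbert_dist_convex[OF \<delta>(1) wD(1) \<delta>(2) wD(2) s(1)] unfolding c .
  have "z \<noteq> z'" using gt hilbert_dist_nonneg[OF assms(1,2)] by (auto simp: hilbert_dist_def)
  have "hilbert_dist D (w \<delta>) (w' \<delta>) < hilbert_dist D z z'"
  proof (cases "F z = F z'")
    case True
    then have "hilbert_dist D (w \<delta>) (w' \<delta>) = 0" by (simp add: w_def w'_def hilbert_dist_def)
    then show ?thesis using hilbert_dist_pos[OF z \<open>z \<noteq> z'\<close>] by simp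
  next
    case False
    have "hilbert_dist D (w \<delta>) (w' \<delta>) < hilbert_dist D (F z) (F z')"
      unfolding w_def w'_def by (rule hilbert_dist_shrink[OF assms(1) Fz False t])
    then show ?thesis using nonexpansive[OF z] by simp
  qed
  then show False using le \<delta>(3) by simp
qed

text \<open>
  By the resolvent identity, \<open>R m x0\<close> is the image under \<open>R l\<close> of a point of the segment
  from \<open>R m x0\<close> to \<open>x0\<close>.
\<close>

lemma resolvent_dist:
  assumes "x \<in> D" "x0 \<in> D" "0 < l" "l \<le> m"
  shows "hilbert_dist D (R l x) (R m x0) \<le> hilbert_dist D x0 (R m x0) + hilbert_dist D x x0"
proof -
  define y where "y = R m x0"
  \<comment> \<open>With this weight, the equation of \<open>R m x0\<close> turns into that of
    \<open>R l q\<close>, with the same solution \<open>y\<close>.\<close>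
  define s where "s = l / m"
  define q where "q = s *\<^sub>R x0 + (1 - s) *\<^sub>R y"
  have s: "s \<in> {0..1}" "s * m = l" using assms by (auto simp: s_def)
  have y: "y \<in> D" using resolvent_in assms by (simp add: y_def)
  have q: "q \<in> D" unfolding q_def using convexD[OF convex_D assms(2) y] s(1) by simp
  have "q + l *\<^sub>R F y = s *\<^sub>R (x0 + m *\<^sub>R F y) + (1 - s) *\<^sub>R y"
    by (simp add: q_def scaleR_right_distrib s(2))
  also have "\<dots> = s *\<^sub>R ((1 + m) *\<^sub>R y) + (1 - s) *\<^sub>R y"
    using resolvent_equation[of x0 m] assms by (simp add: y_def)
  also have "\<dots> = (1 + s * m) *\<^sub>R y" by (simp add: algebra_simps)
  finally have "(1 + l) *\<^sub>R y = q + l *\<^sub>R F y" unfolding s(2) by simp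
  then have "R l q = y" using resolvent_unique q assms(3) y by blast
  then have "hilbert_dist D (R l x) y \<le> hilbert_dist D x q"
    using resolvent_nonexpansive[OF assms(1) q assms(3)] by simp
  \<comment> \<open>Writing \<open>x\<close> as a combination of itself with itself lets the
    convexity hypothesis bound its distance to \<open>q\<close>.\<close>
  also have "\<dots> = hilbert_dist D (s *\<^sub>R x + (1 - s) *\<^sub>R x) q" by (simp flip: scaleR_left_distrib)
  also have "\<dots> \<le> max (hilbert_dist D x x0) (hilbert_dist D x y)"
    unfolding q_def by (rule hilbert_dist_convex[OF assms(1,1,2) y s(1)])
  also have "\<dots> \<le> hilbert_dist D x0 y + hilbert_dist D x x0"
    using hilbert_dist_triangle[OF assms(1,2) y] hilbert_dist_nonneg[OF assms(1,2)]
      hilbert_dist_nonneg[OF assms(2) y] by simp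
  finally show ?thesis by (simp add: y_def)
qed

section \<open>Limit points of resolvents\<close>

lemma attractor_obtain:
  assumes "z \<in> attractor D R"
  obtains x l where "x \<in> D" "\<And>n. l n > 0" "filterlim l at_top sequentially"
    "(\<lambda>n. R (l n) x) \<longlonglongrightarrow> z" "z \<in> closure D"
proof -
  obtain x l where xl: "x \<in> D" "\<And>n. l n > 0" "filterlim l at_top sequentially"
    "(\<lambda>n. norm (R (l n) x - z)) \<longlonglongrightarrow> 0" "z \<in> closure D"
    using assms unfolding attractor_def omega_limit_def by blast
  have "(\<lambda>n. R (l n) x) \<longlonglongrightarrow> z"
    by (rule LIM_zero_cancel[OF tendsto_norm_zero_cancel[OF xl(4)]])
  from that[OF xl(1-3) this xl(5)] show ?thesis .
qed

text \<open>The resolvent equation gives \<open>F (y n) - y n = (y n - x) / l n\<close>, which tends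
  to 0, and \<open>F\<close> is continuous at \<open>z\<close> because \<open>z\<close> lies in
  \<open>D\<close>.\<close>

lemma attractor_fixed_point:
  assumes "z \<in> attractor D R" "z \<in> D"
  shows "F z = z"
proof -
  obtain x l where x: "x \<in> D" "\<And>n. l n > 0" "filterlim l at_top sequentially"
    "(\<lambda>n. R (l n) x) \<longlonglongrightarrow> z" "z \<in> closure D"
    using attractor_obtain[OF assms(1)] by blast
  define y where "y n = R (l n) x" for n
  have y: "y n \<in> D" for n using resolvent_in x by (simp add: y_def)
  have yz: "y \<longlonglongrightarrow> z" using x(4) by (simp add: y_def[abs_def])
  have Fy: "F (y n) = y n + inverse (l n) *\<^sub>R (y n - x)" for n
  proof -
    have "l n *\<^sub>R F (y n) = l n *\<^sub>R y n + (y n - x)"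
      using resolvent_equation[OF x(1) x(2)[of n]] by (simp add: y_def algebra_simps)
    also have "\<dots> = l n *\<^sub>R (y n + inverse (l n) *\<^sub>R (y n - x))"
      using x(2)[of n] by (simp add: scaleR_right_distrib)
    finally show ?thesis by (rule scaleR_left_imp_eq[rotated]) (use x(2)[of n] in simp)
  qed
  have "(\<lambda>n. inverse (l n)) \<longlonglongrightarrow> 0"
    using x(3) tendsto_inverse_0_at_top by blast
  then have "(\<lambda>n. y n + inverse (l n) *\<^sub>R (y n - x)) \<longlonglongrightarrow> z + 0 *\<^sub>R (z - x)"
    by (intro tendsto_intros yz)
  then have "(\<lambda>n. F (y n)) \<longlonglongrightarrow> z" by (simp add: Fy)
  moreover have "(\<lambda>n. F (y n)) \<longlonglongrightarrow> F z" using F_tendsto[OF assms(2) yz] y by simp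
  ultimately show ?thesis using LIMSEQ_unique by blast
qed

text \<open>
  If \<open>v = R l x\<close> is close to \<open>u\<close> and \<open>z\<close> is not in the face of \<open>u\<close>, then the factor
  \<open>order_ratio D (R m x0) v\<close> of \<open>exp (d v (R m x0))\<close> is large, so the bound of
  \<open>resolvent_dist\<close> forces the other factor to be small compared with \<open>order_ratio D x0 (R m x0)\<close>.
\<close>

lemma attractor_absorbed_or_dominated:
  assumes u: "u \<in> attractor D R" and x0: "x0 \<in> D" and m: "\<And>n. m n > 0"
    "filterlim m at_top sequentially" and z: "(\<lambda>n. R (m n) x0) \<longlonglongrightarrow> z"
    and nd: "\<And>t. \<not> dominated D t z u"
  shows "u \<in> absorbed x0 (\<lambda>n. R (m n) x0)"
proof -
  obtain x l where x: "x \<in> D" "\<And>n. l n > 0" "filterlim l at_top sequentially"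
    "(\<lambda>n. R (l n) x) \<longlonglongrightarrow> u" "u \<in> closure D"
    using attractor_obtain[OF u] by blast
  define y v where "y n = R (m n) x0" and "v k = R (l k) x" for n k
  have y: "y n \<in> D" and v: "v n \<in> D" for n
    using resolvent_in x m x0 by (auto simp: y_def v_def)
  have yz: "y \<longlonglongrightarrow> z" and vu: "v \<longlonglongrightarrow> u" using z x(4) by (simp_all add: y_def[abs_def] v_def[abs_def])
  obtain r where r: "r > 0" "cball x0 r \<subseteq> closure D" using cball_in_closure[OF x0] .
  obtain B where B: "\<And>n. norm (y n - x0) \<le> B"
    using convergent_imp_bounded[OF tendsto_diff[OF yz tendsto_const[of x0]]] by (auto simp: bounded_iff)
  \<comment> \<open>The factor \<open>1 + B / r\<close> bounds
    \<open>order_ratio D (y n) x0\<close>, since \<open>x0\<close> is interior and the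
    \<open>y n\<close> are bounded; only \<open>order_ratio D x0 (y n)\<close> can grow.\<close>
  define C where "C = (1 + B / r) * exp (hilbert_dist D x x0)"
  have "B \<ge> 0" using B[of 0] norm_ge_zero order_trans by blast
  then have C: "C > 0" using r by (simp add: C_def add_pos_nonneg)
  have bound: "order_ratio D (v k) (y n) * order_ratio D (y n) (v k) \<le> C * order_ratio D x0 (y n)"
    if "l k \<le> m n" for k n
  proof -
    have "order_ratio D (v k) (y n) * order_ratio D (y n) (v k) = exp (hilbert_dist D (v k) (y n))"
      using exp_hilbert_dist[OF v y] by simp
    also have "\<dots> \<le> exp (hilbert_dist D x0 (y n) + hilbert_dist D x x0)"
      using resolvent_dist[OF x(1) x0 x(2) that] by (simp add: v_def y_def)
    also have "\<dots> = order_ratio D x0 (y n) * order_ratio D (y n) x0 * exp (hilbert_dist D x x0)"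
      by (simp add: exp_add exp_hilbert_dist x0 y)
    also have "\<dots> \<le> order_ratio D x0 (y n) * (1 + B / r) * exp (hilbert_dist D x x0)"
    proof -
      have "order_ratio D (y n) x0 \<le> 1 + norm (y n - x0) / r"
        by (rule order_ratio_near[OF y x0 r(2,1)])
      also have "\<dots> \<le> 1 + B / r" using B[of n] r by (simp add: divide_right_mono)
      finally show ?thesis using order_ratio_pos[OF x0 y, of n]
        by (intro mult_right_mono mult_left_mono) auto
    qed
    also have "\<dots> = C * order_ratio D x0 (y n)" by (simp add: C_def)
    finally show ?thesis .
  qed
  have "u \<in> absorbed x0 y"
  proof (rule absorbed_approx[OF x0 y x(5)])
    fix e :: real assume e: "e > 0"
    \<comment> \<open>A reverse ratio of at least \<open>C / e\<close> leaves at most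
      \<open>e\<close> times the normalising ratio for the other factor.\<close>
    define T where "T = max 2 (C / e)"
    have T: "T > 1" "C \<le> T * e" using e by (auto simp: T_def field_simps max_def)
    \<comment> \<open>Non-domination passes from the limits to the sequences in two stages: first
      \<open>k\<close> is fixed with \<open>v k\<close> near \<open>u\<close>, then \<open>n\<close>
      grows, which also ensures \<open>l k \<le> m n\<close>.\<close>
    have "\<not> (\<exists>\<^sub>F k in sequentially. dominated D T z (v k))"
      using dominated_limit[OF T(1) tendsto_const vu, of D z] nd by blast
    then have "\<forall>\<^sub>F k in sequentially. \<not> dominated D T z (v k)" by (simp add: not_frequently)
    moreover have "\<forall>\<^sub>F k in sequentially. dist (v k) u < e" using tendstoD[OF vu e] .
    ultimately have "\<forall>\<^sub>F k in sequentially. \<not> dominated D T z (v k) \<and> dist (v k) u < e"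
      by (rule eventually_conj)
    then obtain k where k: "\<not> dominated D T z (v k)" "dist (v k) u < e"
      using eventually_happens'[OF sequentially_bot] by blast
    have "\<not> (\<exists>\<^sub>F n in sequentially. dominated D T (y n) (v k))"
      using dominated_limit[OF T(1) yz tendsto_const, of D "v k"] k(1) by blast
    then have "\<forall>\<^sub>F n in sequentially. \<not> dominated D T (y n) (v k)" by (simp add: not_frequently)
    moreover have "\<forall>\<^sub>F n in sequentially. l k \<le> m n"
      using m(2) by (simp add: filterlim_at_top)
    ultimately have "\<forall>\<^sub>F n in sequentially. dominated D (e * order_ratio D x0 (y n)) (v k) (y n)"
    proof eventually_elim
      case (elim n)
      have "T \<le> order_ratio D (y n) (v k)"
      proof (rule ccontr)
        assume "\<not> ?thesis"
        then have "dominated D T (y n) (v k)"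
          by (intro dominated_mono[OF order_ratio_dominated[OF y v] _ in_closure[OF v]]) simp
        then show False using elim(1) by blast
      qed
      then have "order_ratio D (v k) (y n) * T \<le> order_ratio D (v k) (y n) * order_ratio D (y n) (v k)"
        using order_ratio_pos[OF v y] by (intro mult_left_mono) (auto intro: less_imp_le)
      also have "\<dots> \<le> C * order_ratio D x0 (y n)" by (rule bound[OF elim(2)])
      also have "\<dots> \<le> (T * e) * order_ratio D x0 (y n)"
        using T(2) order_ratio_pos[OF x0 y] by (intro mult_right_mono) (auto intro: less_imp_le)
      finally have "order_ratio D (v k) (y n) * T \<le> (e * order_ratio D x0 (y n)) * T"
        by (simp add: mult_ac)
      then have "order_ratio D (v k) (y n) \<le> e * order_ratio D x0 (y n)"
        by (rule mult_right_le_imp_le) (use T(1) in simp)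
      then show ?case
        by (rule dominated_mono[OF order_ratio_dominated[OF v y] _ in_closure[OF y]])
    qed
    then show "\<exists>u'. norm (u' - u) < e \<and>
        (\<forall>\<^sub>F n in sequentially. dominated D (e * order_ratio D x0 (y n)) u' (y n))"
      using k(2) by (intro exI[of _ "v k"]) (simp add: dist_norm)
  qed
  then show ?thesis by (simp add: y_def[abs_def])
qed

section \<open>The convex hull of the attractor\<close>

text \<open>Finiteness of \<open>S\<close> provides a point \<open>z\<close> with maximal face; a
  sequence of resolvents tending to this \<open>z\<close> absorbs all of \<open>S\<close> at
  once.\<close>

lemma hull_attractor_disjoint:
  assumes nofix: "\<And>x. x \<in> D \<Longrightarrow> F x \<noteq> x"
    and S: "finite S" "S \<noteq> {}" "S \<subseteq> attractor D R"
  shows "convex hull S \<inter> D = {}"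
proof -
  \<comment> \<open>This is the smallest face of the closure containing \<open>u\<close>.\<close>
  define Z where "Z u = {w \<in> closure D. \<exists>t. dominated D t w u}" for u
  have cl: "u \<in> closure D" if "u \<in> S" for u
    using attractor_obtain[of u "u \<in> closure D"] that S(3) by blast
  have "finite (Z ` S)" "Z ` S \<noteq> {}" using S by auto
  from finite_has_maximal[OF this] obtain z where z: "z \<in> S"
    and max: "\<And>u. u \<in> S \<Longrightarrow> Z z \<subseteq> Z u \<Longrightarrow> Z z = Z u" by auto
  have zO: "z \<in> attractor D R" using z S(3) by blast
  obtain x0 m where x0: "x0 \<in> D" "\<And>n. m n > 0" "filterlim m at_top sequentially"
    "(\<lambda>n. R (m n) x0) \<longlonglongrightarrow> z" "z \<in> closure D"
    using attractor_obtain[OF zO] by blast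
  define y where "y n = R (m n) x0" for n
  have y: "y n \<in> D" for n using resolvent_in x0 by (simp add: y_def)
  have zD: "z \<notin> D" using attractor_fixed_point[OF zO] nofix by blast
  have za: "z \<in> absorbed x0 y"
    by (rule limit_in_absorbed[OF x0(1) y _ zD cl[OF z]]) (use x0(4) in \<open>simp add: y_def[abs_def]\<close>)
  have "u \<in> absorbed x0 y" if u: "u \<in> S" for u
  proof (cases "\<exists>t. dominated D t z u")
    case True
    \<comment> \<open>By transitivity the face of \<open>z\<close> lies in that of \<open>u\<close>;
      maximality makes them equal, so \<open>u\<close> lies in the face of \<open>z\<close>, which
      is absorbed together with \<open>z\<close>.\<close>
    then have "Z z \<subseteq> Z u" unfolding Z_def using dominated_trans by blast
    then have "Z z = Z u" using max u by blast
    moreover have "u \<in> Z u" using dominated_refl[OF cl[OF u]] cl[OF u] by (auto simp: Z_def)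
    ultimately have "u \<in> Z z" by simp
    then show ?thesis using absorbed_dominated[OF za] by (auto simp: Z_def)
  next
    case False
    then show ?thesis
      using attractor_absorbed_or_dominated[OF _ x0(1-4), of u] u S(3) unfolding y_def[abs_def] by blast
  qed
  then have "convex hull S \<subseteq> absorbed x0 y"
    by (intro hull_minimal convex_absorbed) auto
  moreover have "absorbed x0 y \<inter> D = {}" by (rule absorbed_disjoint[OF x0(1) y])
  ultimately show ?thesis by blast
qed

text \<open>Every point of the hull is a finite convex combination, which reduces disjointness from
  \<open>D\<close> to finite subsets of the attractor.\<close>

lemma hull_attractor_subset:
  assumes "\<And>x. x \<in> D \<Longrightarrow> F x \<noteq> x"
  shows "convex hull (attractor D R) \<subseteq> closure D - D"
proof
  fix p assume p: "p \<in> convex hull (attractor D R)"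
  have "attractor D R \<subseteq> closure D" by (auto simp: attractor_def omega_limit_def)
  then have "convex hull (attractor D R) \<subseteq> closure D" by (rule hull_minimal) (rule convex_closure_D)
  moreover from p obtain S c where S: "finite S" "S \<subseteq> attractor D R" "\<forall>x\<in>S. 0 \<le> c x" "sum c S = 1"
    "(\<Sum>v\<in>S. c v *\<^sub>R v) = p" unfolding convex_hull_explicit by blast
  then have "S \<noteq> {}" by auto
  have "p \<in> convex hull S"
    unfolding S(5)[symmetric] using S
    by (intro convex_sum convex_convex_hull hull_inc) auto
  then have "p \<notin> D" using hull_attractor_disjoint[OF assms S(1) \<open>S \<noteq> {}\<close> S(2)] by blast
  ultimately show "p \<in> closure D - D" using p by blast
qed

end

theorem theorem4p3:
  fixes D :: "'a::real_normed_vector set" and F :: "'a \<Rightarrow> 'a"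
  assumes "\<exists>B :: 'a set. finite B \<and> span B = UNIV"
    and "D \<noteq> {}" and "open D" and "connected D"
    and "bounded D" and "convex D"
    and "\<And>x y z w s. \<lbrakk>x \<in> D; y \<in> D; z \<in> D; w \<in> D; s \<in> {0..1}\<rbrakk> \<Longrightarrow>
           hilbert_dist D (s *\<^sub>R x + (1 - s) *\<^sub>R y) (s *\<^sub>R z + (1 - s) *\<^sub>R w)
             \<le> max (hilbert_dist D x z) (hilbert_dist D y w)"
    and "F \<in> D \<rightarrow> D"
    and "hilbert_nonexpansive D F"
    and "\<forall>x\<in>D. F x \<noteq> x"
  shows "convex hull (attractor D (resolvent D F)) \<subseteq> closure D - D"
proof -
  have "compact (closure D)" using assms(1,5) compact_closure_of_finite_span by blast
  then interpret hilbert_nonexpansive_map D F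
    using assms(3,5-9) by unfold_locales (auto simp: hilbert_nonexpansive_def)
  show ?thesis using hull_attractor_subset assms(10) by blast
qed

end
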